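(* For every $n\geq 4$, the poset $\mathcal{E}_n$ is not a lattice.
   Context: All graphs are finite and simple. The chromatic symmetric function of a graph $G$ with vertices $v_1,\dots,v_n$ is $X_G=\sum_{\kappa}x_{\kappa(v_1)}\cdots x_{\kappa(v_n)}$, summed over all proper colorings $\kappa:V(G)\to\{1,2,3,\dots\}$; it is a homogeneous symmetric function of degree $n$ over $\mathbb{Q}$. Let $e_\lambda=e_{\lambda_1}e_{\lambda_2}\cdots$ be the elementary symmetric functions; $[e_\lambda]F$ denotes the coefficient of $e_\lambda$ in $F$ expanded in this basis, and $F$ is $e$-positive if $[e_\lambda]F\ge 0$ for all $\lambda$. For connected graphs $G,H$ on $n$ vertices (for which $[e_{(n)}]X_G$ and $[e_{(n)}]X_H$ are positive), set $$X_e(G,H)=X_G-\frac{[e_{(n)}]X_G}{[e_{(n)}]X_H}X_H.$$ $\mathcal{E}_n$ is the poset whose elements are the equivalence classes of connected graphs on $n$ vertices under $G\sim H\iff X_G=X_H$, ordered by $G\geq_e H$ if and only if $X_e(G,H)$ is $e$-positive. *)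

theory Defs
  imports
    Complex_Main
    "HOL-Library.Multiset"
    "HOL-Library.FuncSet"
    "HOL-Algebra.Lattice"
    "Graph_Theory.Graph_Theory"
begin

section \<open>Formal power series in countably many variables\<close>

text \<open>
  The ring of formal power series over the rationals in variables indexed by \<^typ>\<open>nat\<close>.
  The monomial that is the product of the variables with indices i1, ..., ik is represented by the
  multiset {i1, ..., ik}, so the product of two monomials is the sum of multisets.
  The colours/variables are numbered from 0 rather than from 1.
\<close>

typedef mps = "UNIV :: (nat multiset \<Rightarrow> rat) set"
  morphisms mcoeff Abs_mps ..

setup_lifting type_definition_mps

lemma mps_eqI: "(\<And>m. mcoeff F m = mcoeff G m) \<Longrightarrow> F = G"
  by transfer auto

lemma finite_msplit: "finite {(a, b). a + b = (m :: nat multiset)}"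
proof (rule finite_subset)
  let ?S = "mset ` {xs. set xs \<subseteq> set_mset m \<and> length xs \<le> size m}"
  show "{(a, b). a + b = m} \<subseteq> ?S \<times> ?S"
  proof (clarsimp)
    fix a b :: "nat multiset"
    obtain xs ys where "a = mset xs" "b = mset ys"
      by (metis ex_mset)
    then show "a \<in> mset ` {xs. set xs \<subseteq> set_mset a \<union> set_mset b \<and> length xs \<le> size a + size b} \<and>
      b \<in> mset ` {xs. set xs \<subseteq> set_mset a \<union> set_mset b \<and> length xs \<le> size a + size b}"
      by auto
  qed
  show "finite (?S \<times> ?S)"
    using finite_lists_length_le[of "set_mset m"] by auto
qed

instantiation mps :: comm_ring_1
begin

lift_definition zero_mps :: mps is "\<lambda>_. 0" .

lift_definition one_mps :: mps is "\<lambda>m. of_bool (m = {#})" .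

lift_definition plus_mps :: "mps \<Rightarrow> mps \<Rightarrow> mps" is "\<lambda>F G m. F m + G m" .

lift_definition minus_mps :: "mps \<Rightarrow> mps \<Rightarrow> mps" is "\<lambda>F G m. F m - G m" .

lift_definition uminus_mps :: "mps \<Rightarrow> mps" is "\<lambda>F m. - F m" .

lift_definition times_mps :: "mps \<Rightarrow> mps \<Rightarrow> mps" is
  "\<lambda>F G m. \<Sum>(a, b) | a + b = m. F a * G b" .

instance
proof
  fix F G H :: mps
  show "F * G * H = F * (G * H)"
  proof transfer
    fix F G H :: "nat multiset \<Rightarrow> rat"
    show "(\<lambda>m. \<Sum>(p, c) | p + c = m. (\<Sum>(a, b) | a + b = p. F a * G b) * H c) =
      (\<lambda>m. \<Sum>(a, q) | a + q = m. F a * (\<Sum>(b, c) | b + c = q. G b * H c))" (is "?L = ?R")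
    proof
      fix m
      have "?L m = (\<Sum>x | fst x + snd x = m.
          \<Sum>y | fst y + snd y = fst x. F (fst y) * G (snd y) * H (snd x))"
        by (simp add: case_prod_beta' sum_distrib_right)
      also have "\<dots> = (\<Sum>(x, y) \<in> (SIGMA x : {x. fst x + snd x = m}. {y. fst y + snd y = fst x}).
          F (fst y) * G (snd y) * H (snd x))"
        by (rule sum.Sigma) (use finite_msplit in \<open>auto simp: case_prod_beta'\<close>)
      also have "\<dots> = (\<Sum>(x, y) \<in> (SIGMA x : {x. fst x + snd x = m}. {y. fst y + snd y = snd x}).
          F (fst x) * (G (fst y) * H (snd y)))"
        by (rule sum.reindex_bij_witness[where
              i = "\<lambda>((a, q), (b, c)). ((a + b, c), (a, b))" and
              j = "\<lambda>((p, c), (a, b)). ((a, b + c), (b, c))"])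
          (auto simp: add.assoc mult.assoc)
      also have "\<dots> = (\<Sum>x | fst x + snd x = m.
          \<Sum>y | fst y + snd y = snd x. F (fst x) * (G (fst y) * H (snd y)))"
        by (rule sum.Sigma[symmetric]) (use finite_msplit in \<open>auto simp: case_prod_beta'\<close>)
      also have "\<dots> = ?R m"
        by (simp add: case_prod_beta' sum_distrib_left)
      finally show "?L m = ?R m" .
    qed
  qed
  show "F * G = G * F"
  proof transfer
    fix F G :: "nat multiset \<Rightarrow> rat"
    show "(\<lambda>m. \<Sum>(a, b) | a + b = m. F a * G b) = (\<lambda>m. \<Sum>(a, b) | a + b = m. G a * F b)"
      by (rule ext, rule sum.reindex_bij_witness[where i = prod.swap and j = prod.swap])
        (auto simp: add.commute mult.commute)
  qed
  show "1 * F = F"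
  proof transfer
    fix F :: "nat multiset \<Rightarrow> rat"
    have "(\<Sum>(a, b) | a + b = m. of_bool (a = {#}) * F b) = (\<Sum>x \<in> {({#} :: nat multiset, m)}. F (snd x))" for m
      by (rule sum.mono_neutral_cong_right) (use finite_msplit in auto)
    then show "(\<lambda>m. \<Sum>(a, b) | a + b = m. of_bool (a = {#}) * F b) = F"
      by auto
  qed
  show "(F + G) * H = F * H + G * H"
    by transfer (auto simp: case_prod_beta' distrib_right sum.distrib)
  show "(0 :: mps) \<noteq> 1"
    by transfer (auto simp: fun_eq_iff)
qed (transfer; auto)+

end

lift_definition mps_scale :: "rat \<Rightarrow> mps \<Rightarrow> mps" is "\<lambda>c F m. c * F m" .

global_interpretation mps: vector_space mps_scale
  by standard (transfer; auto simp: algebra_simps)+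


section \<open>Elementary symmetric functions\<close>

lift_definition elem_sym :: "nat \<Rightarrow> mps" is
  "\<lambda>k m. of_bool (size m = k \<and> (\<forall>i. count m i \<le> 1))" .

text \<open>An integer partition is the multiset of its (positive) parts.\<close>

definition partitions :: "nat multiset set" where
  "partitions = {\<mu>. 0 \<notin># \<mu>}"

definition e_part :: "nat multiset \<Rightarrow> mps" where
  "e_part \<mu> = (\<Prod>k \<in># \<mu>. elem_sym k)"

text \<open>
  \<^term>\<open>mps.representation\<close> yields the coordinates with respect to a linearly independent family of
  vectors; it is meaningful for vectors in the span of the family, which here is the space of
  symmetric functions, and 0 for all others.
\<close>

definition e_coeff :: "nat multiset \<Rightarrow> mps \<Rightarrow> rat" where
  "e_coeff \<mu> F = mps.representation (e_part ` partitions) F (e_part \<mu>)"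

definition e_positive :: "mps \<Rightarrow> bool" where
  "e_positive F \<longleftrightarrow> (\<forall>\<mu> \<in> partitions. e_coeff \<mu> F \<ge> 0)"


section \<open>Chromatic symmetric functions\<close>

text \<open>
  A finite simple graph is a \<^locale>\<open>pair_graph\<close>: each edge is the pair of arcs (u, v), (v, u).
  Colourings are taken in \<^const>\<open>extensional\<close> form, so that each one is counted once.
\<close>

definition proper_colourings :: "'a pair_pre_digraph \<Rightarrow> ('a \<Rightarrow> nat) set" where
  "proper_colourings G =
     {\<kappa> \<in> pverts G \<rightarrow>\<^sub>E UNIV. \<forall>(u, v) \<in> parcs G. \<kappa> u \<noteq> \<kappa> v}"

text \<open>
  The coefficient of a monomial is the number of proper colourings contributing it. For a finite
  graph there are only finitely many of these.
\<close>

lift_definition chromatic_sym :: "'a pair_pre_digraph \<Rightarrow> mps" is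
  "\<lambda>G m. of_nat (card {\<kappa> \<in> proper_colourings G. image_mset \<kappa> (mset_set (pverts G)) = m})" .

definition X_e :: "'a pair_pre_digraph \<Rightarrow> 'a pair_pre_digraph \<Rightarrow> mps" where
  "X_e G H = chromatic_sym G -
     mps_scale (e_coeff {#card (pverts G)#} (chromatic_sym G) /
                e_coeff {#card (pverts H)#} (chromatic_sym H)) (chromatic_sym H)"


section \<open>The poset of connected graphs on n vertices\<close>

text \<open>Up to isomorphism, every finite graph has its vertices in \<^typ>\<open>nat\<close>.\<close>

definition connected_graphs :: "nat \<Rightarrow> nat pair_pre_digraph set" where
  "connected_graphs n =
     {G. pair_graph G \<and> Digraph_Component.connected (with_proj G) \<and> card (pverts G) = n}"

definition chromatic_equiv :: "nat \<Rightarrow> nat pair_pre_digraph rel" where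
  "chromatic_equiv n = {(G, H). G \<in> connected_graphs n \<and> H \<in> connected_graphs n \<and>
     chromatic_sym G = chromatic_sym H}"

text \<open>
  \<^const>\<open>X_e\<close> depends only on the classes of its arguments, so any representatives may be used.
\<close>

definition e_poset :: "nat \<Rightarrow> nat pair_pre_digraph set gorder" where
  "e_poset n =
     \<lparr> carrier = connected_graphs n // chromatic_equiv n,
       eq = (=),
       le = (\<lambda>C D. \<exists>H \<in> C. \<exists>G \<in> D. e_positive (X_e G H)) \<rparr>"

end

theory Submission
  imports Defs
begin

text \<open>
  The coefficient of the squarefree monomial of degree n is the same positive number (namely n!) in
  all chromatic symmetric functions of graphs on n vertices, and it is positive in every e-basis
  element of degree n. Comparing it in X_e(G, H) shows that G \<ge> H implies
  [e_n] X_G \<le> [e_n] X_H, with equality only if X_G = X_H. Deletion-contraction gives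
  [e_n] X_G \<ge> n for every connected graph, with equality for trees, so all trees are maximal.
  The star and the path are trees with different chromatic symmetric functions once n \<ge> 4 (only the
  star has a proper colouring with a colour class of size n - 1), hence they have no common upper
  bound.
\<close>


section \<open>The elementary basis\<close>

text \<open>Contracting an edge lowers the degree of the chromatic symmetric function, so
  deletion-contraction does not hold for it as it stands. The remedy is to keep the vertex set and
  to let a block of identified vertices contribute its colour once per vertex: every series then
  stays homogeneous of degree \<open>card V\<close>, and a fully contracted connected graph yields
  the power sum of that degree. Its top coefficient is (-1)^(n-1) n, obtained by a Newton-type
  recursion through hook monomials; this is the origin of the bound n. Contraction across two blocks
  lowers the number of blocks by one, so the sign (-1)^(card V + number of blocks) turns the
  difference into a sum of nonnegative terms. For a connected graph without loops one summand always
  keeps the full size n; for a tree the other one vanishes. The second obstacle is that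
  \<open>e_coeff\<close> is linear only on the span of an independent family: independence of the
  \<open>e_part \<mu>\<close> and membership of every series in the span come before any comparison
  of coefficients.\<close>

lemma mcoeff_simps [simp]:
  "mcoeff 0 m = 0" "mcoeff 1 m = of_bool (m = {#})"
  "mcoeff (F + G) m = mcoeff F m + mcoeff G m"
  "mcoeff (F - G) m = mcoeff F m - mcoeff G m"
  "mcoeff (- F) m = - mcoeff F m"
  "mcoeff (mps_scale c F) m = c * mcoeff F m"
  "mcoeff (elem_sym k) m = of_bool (size m = k \<and> (\<forall>i. count m i \<le> 1))"
  by (transfer; simp)+

lemma mcoeff_times: "mcoeff (F * G) m = (\<Sum>(a, b) | a + b = m. mcoeff F a * mcoeff G b)"
  by transfer simp

lemma mcoeff_sum: "mcoeff (sum f A) m = (\<Sum>x\<in>A. mcoeff (f x) m)"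
  by (induction A rule: infinite_finite_induct) auto

lemma squarefree_eq_mset_set:
  assumes "\<And>i. count m i \<le> 1"
  shows "m = mset_set (set_mset m)"
proof (rule multiset_eqI)
  fix i show "count m i = count (mset_set (set_mset m)) i"
    using assms[of i] by (cases "i \<in># m") (auto simp: not_in_iff count_greater_zero_iff[symmetric] simp del: count_greater_zero_iff)
qed

lemma e_part_empty [simp]: "e_part {#} = 1"
  and e_part_add [simp]: "e_part (add_mset k \<mu>) = elem_sym k * e_part \<mu>"
  and e_part_union: "e_part (\<mu> + \<nu>) = e_part \<mu> * e_part \<nu>"
  by (simp_all add: e_part_def)

lemma mps_scale_mult_left: "mps_scale c F * G = mps_scale c (F * G)"
  by (rule mps_eqI) (simp add: mcoeff_times sum_distrib_left case_prod_beta' mult.assoc)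

lemma mps_scale_mult_right: "F * mps_scale c G = mps_scale c (F * G)"
  by (metis mps_scale_mult_left mult.commute)

text \<open>
  Independence is shown by triangularity with respect to the weight of a monomial, the sum of its
  variable indices: the monomial of least weight in \<^term>\<open>e_part \<mu>\<close> is unique, has coefficient 1
  and determines \<^term>\<open>\<mu>\<close>.
\<close>

definition lead_weight :: "nat multiset \<Rightarrow> nat" where "lead_weight \<mu> = (\<Sum>k\<in>#\<mu>. \<Sum>{..<k})"

definition lead_monomial :: "nat multiset \<Rightarrow> nat multiset" where "lead_monomial \<mu> = (\<Sum>k\<in>#\<mu>. mset_set {..<k})"

text \<open>Induction on the largest element \<open>b\<close>: the rest lies below \<open>b\<close>,
  so its size is at most \<open>b\<close>. The bound and its equality case both split into one for
  \<open>b\<close> and one for the rest.\<close>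

lemma initial_segment_min_sum:
  fixes A :: "nat set"
  assumes "finite A"
  shows "\<Sum>{..<card A} \<le> \<Sum>A" and "\<Sum>A \<le> \<Sum>{..<card A} \<Longrightarrow> A = {..<card A}"
proof -
  have "\<Sum>{..<card A} \<le> \<Sum>A \<and> (\<Sum>A \<le> \<Sum>{..<card A} \<longrightarrow> A = {..<card A})"
    using assms
  proof (induction rule: finite_linorder_max_induct)
    case (insert b A)
    have sub: "A \<subseteq> {..<b}" using insert by auto
    then have le: "card A \<le> b" using card_mono[OF _ sub] by simp
    have eq: "\<Sum>(insert b A) = b + \<Sum>A" "card (insert b A) = Suc (card A)"
      using insert by (auto simp: card_insert_if)
    have S: "\<Sum>{..<Suc (card A)} = card A + \<Sum>{..<card A}" by simp
    have "insert b A = {..<Suc (card A)}" if "b + \<Sum>A \<le> card A + \<Sum>{..<card A}"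
    proof -
      have "b = card A" "\<Sum>A \<le> \<Sum>{..<card A}" using insert.IH le that by linarith+
      then have "A = {..<card A}" using insert.IH by blast
      with \<open>b = card A\<close> show ?thesis by (metis lessThan_Suc)
    qed
    moreover have "card A + \<Sum>{..<card A} \<le> b + \<Sum>A" using insert.IH le by linarith
    ultimately show ?case unfolding eq S by blast
  qed simp
  then show "\<Sum>{..<card A} \<le> \<Sum>A" and "\<Sum>A \<le> \<Sum>{..<card A} \<Longrightarrow> A = {..<card A}" by auto
qed

lemma elem_sym_lead:
  assumes "mcoeff (elem_sym k) a \<noteq> 0"
  shows "\<Sum>{..<k} \<le> \<Sum>\<^sub># a" and "\<Sum>\<^sub># a \<le> \<Sum>{..<k} \<Longrightarrow> a = mset_set {..<k}"
proof -
  have a: "a = mset_set (set_mset a)"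
    using assms by (intro squarefree_eq_mset_set) (auto split: if_splits)
  have k: "card (set_mset a) = k"
    using assms arg_cong[OF a, of size] by (auto split: if_splits)
  have s: "\<Sum>\<^sub># a = \<Sum>(set_mset a)"
    by (subst a) (simp add: sum_unfold_sum_mset)
  show "\<Sum>{..<k} \<le> \<Sum>\<^sub># a"
    using initial_segment_min_sum(1)[of "set_mset a"] by (simp add: k s)
  show "a = mset_set {..<k}" if "\<Sum>\<^sub># a \<le> \<Sum>{..<k}"
    using initial_segment_min_sum(2)[of "set_mset a"] a that by (simp add: k s)
qed

text \<open>Weights add up under multiplication of monomials, so the minimum is attained only when
  every factor attains its own.\<close>

lemma e_part_lead_min:
  assumes "mcoeff (e_part \<mu>) m \<noteq> 0"
  shows "lead_weight \<mu> \<le> \<Sum>\<^sub># m \<and> (\<Sum>\<^sub># m \<le> lead_weight \<mu> \<longrightarrow> m = lead_monomial \<mu>)"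
  using assms
proof (induction \<mu> arbitrary: m)
  case empty
  then show ?case by (auto simp: lead_weight_def lead_monomial_def split: if_splits)
next
  case (add k \<mu>)
  have "(\<Sum>(a, b) | a + b = m. mcoeff (elem_sym k) a * mcoeff (e_part \<mu>) b) \<noteq> 0"
    using add.prems by (simp only: e_part_add mcoeff_times not_False_eq_True)
  then obtain x where x: "x \<in> {(a, b). a + b = m}"
      "(case x of (a, b) \<Rightarrow> mcoeff (elem_sym k) a * mcoeff (e_part \<mu>) b) \<noteq> 0"
    using sum.not_neutral_contains_not_neutral by blast
  then obtain a b where ab: "a + b = m" "mcoeff (elem_sym k) a \<noteq> 0" "mcoeff (e_part \<mu>) b \<noteq> 0"
    by auto
  have w: "lead_weight (add_mset k \<mu>) = \<Sum>{..<k} + lead_weight \<mu>" "lead_monomial (add_mset k \<mu>) = mset_set {..<k} + lead_monomial \<mu>"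
    "\<Sum>\<^sub># m = \<Sum>\<^sub># a + \<Sum>\<^sub># b"
    using ab(1) by (auto simp: lead_weight_def lead_monomial_def)
  then show ?case
    using add.IH[OF ab(3)] elem_sym_lead[OF ab(2)] ab(1) by fastforce
qed

lemma sum_mset_lead: "\<Sum>\<^sub># (lead_monomial \<mu>) = lead_weight \<mu>"
  by (induction \<mu>) (auto simp: lead_monomial_def lead_weight_def sum_unfold_sum_mset)

text \<open>The weights of the two factors of a contributing splitting add up to the sum of their
  minima, so both are minimal; exactly one splitting contributes.\<close>

lemma mcoeff_e_part_lead: "mcoeff (e_part \<mu>) (lead_monomial \<mu>) = 1"
proof (induction \<mu>)
  case empty
  then show ?case by (simp add: lead_monomial_def)
next
  case (add k \<mu>)
  let ?f = "\<lambda>(a, b). mcoeff (elem_sym k) a * mcoeff (e_part \<mu>) b"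
  have l: "lead_monomial (add_mset k \<mu>) = mset_set {..<k} + lead_monomial \<mu>" by (simp add: lead_monomial_def)
  have Z: "?f (a, b) = 0" if "a + b = lead_monomial (add_mset k \<mu>)" "(a, b) \<noteq> (mset_set {..<k}, lead_monomial \<mu>)" for a b
  proof (rule ccontr)
    assume "?f (a, b) \<noteq> 0"
    then have nz: "mcoeff (elem_sym k) a \<noteq> 0" "mcoeff (e_part \<mu>) b \<noteq> 0" by auto
    have "\<Sum>\<^sub># a + \<Sum>\<^sub># b = \<Sum>{..<k} + lead_weight \<mu>"
      using arg_cong[OF that(1), of sum_mset] by (simp add: sum_mset_lead) (simp add: lead_weight_def)
    then have "a = mset_set {..<k}" "b = lead_monomial \<mu>"
      using e_part_lead_min[OF nz(2)] elem_sym_lead[OF nz(1)] by auto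
    with that show False by auto
  qed
  have "?f x = 0" if "x \<in> {(a, b). a + b = lead_monomial (add_mset k \<mu>)} - {(mset_set {..<k}, lead_monomial \<mu>)}" for x
    using Z[of "fst x" "snd x"] that by (cases x) simp
  then have "(\<Sum>(a, b) | a + b = lead_monomial (add_mset k \<mu>). mcoeff (elem_sym k) a * mcoeff (e_part \<mu>) b)
    = sum ?f {(mset_set {..<k}, lead_monomial \<mu>)}"
    by (intro sum.mono_neutral_right finite_msplit ballI) (simp_all only: l, simp)
  also have "\<dots> = 1" using add by (simp add: count_mset_set')
  finally show ?case by (simp only: e_part_add mcoeff_times)
qed

text \<open>The exponents of \<open>lead_monomial \<mu>\<close> are the parts of the conjugate
  partition.\<close>

lemma count_lead: "count (lead_monomial \<mu>) j = size (filter_mset (\<lambda>i. j < i) \<mu>)"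
  by (induction \<mu>) (auto simp: lead_monomial_def count_mset_set')

lemma lead_inj: "inj_on lead_monomial partitions"
proof (rule inj_onI)
  fix \<mu> \<nu> assume p: "\<mu> \<in> partitions" "\<nu> \<in> partitions" "lead_monomial \<mu> = lead_monomial \<nu>"
  \<comment> \<open>Differences of consecutive exponents count the parts equal to
    \<open>Suc j\<close>.\<close>
  have c: "size (filter_mset (\<lambda>i. j < i) \<kappa>) = count \<kappa> (Suc j) + size (filter_mset (\<lambda>i. Suc j < i) \<kappa>)"
    for j and \<kappa> :: "nat multiset"
    by (induction \<kappa>) auto
  show "\<mu> = \<nu>"
  proof (rule multiset_eqI)
    fix i show "count \<mu> i = count \<nu> i"
    proof (cases i)
      \<comment> \<open>Parts equal to 0 leave no trace in \<open>lead_monomial\<close>; they are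
        excluded by membership in \<open>partitions\<close>.\<close>
      case 0
      then show ?thesis using p by (auto simp: partitions_def not_in_iff)
    next
      case (Suc j)
      then show ?thesis using c[of j \<mu>] c[of j \<nu>] arg_cong[OF p(3), of "\<lambda>m. count m j"]
          arg_cong[OF p(3), of "\<lambda>m. count m (Suc j)"] by (simp add: count_lead)
    qed
  qed
qed

text \<open>Each lead monomial occurs in the other product, so the two weights bound each other and
  the monomials coincide. Injectivity matters because \<open>e_coeff\<close> addresses the basis
  vector rather than the partition.\<close>

lemma e_part_inj: "inj_on e_part partitions"
proof (rule inj_onI)
  fix \<mu> \<nu> assume p: "\<mu> \<in> partitions" "\<nu> \<in> partitions" "e_part \<mu> = e_part \<nu>"
  then have "mcoeff (e_part \<mu>) (lead_monomial \<nu>) \<noteq> 0" "mcoeff (e_part \<nu>) (lead_monomial \<mu>) \<noteq> 0"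
    by (metis mcoeff_e_part_lead zero_neq_one)+
  then have "lead_monomial \<mu> = lead_monomial \<nu>"
    using e_part_lead_min sum_mset_lead by (metis nle_le)
  then show "\<mu> = \<nu>" using lead_inj p by (auto dest: inj_onD)
qed

lemma e_part_independent: "mps.independent (e_part ` partitions)"
  unfolding mps.independent_explicit_finite_subsets
proof (intro allI impI ballI, rule ccontr)
  fix S u F
  assume S: "S \<subseteq> e_part ` partitions" "finite S" "(\<Sum>v\<in>S. mps_scale (u v) v) = 0"
    and F: "F \<in> S" "u F \<noteq> 0"
  obtain P where P: "P \<subseteq> partitions" "S = e_part ` P"
    using S(1) by (metis subset_image_iff)
  have inj: "inj_on e_part P" using e_part_inj P(1) by (rule inj_on_subset)
  have finP: "finite P" using S(2) P inj by (simp add: finite_image_iff)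
  define Q where "Q = {\<mu> \<in> P. u (e_part \<mu>) \<noteq> 0}"
  have "Q \<noteq> {}" "finite Q" using F finP by (auto simp: Q_def P)
  \<comment> \<open>A partition of least weight among those with nonzero coefficient: its lead
    monomial occurs in no other term of the sum, which isolates its coefficient.\<close>
  then obtain \<mu> where \<mu>: "\<mu> \<in> Q" "\<And>\<nu>. \<nu> \<in> Q \<Longrightarrow> lead_weight \<mu> \<le> lead_weight \<nu>"
    using ex_min_if_finite[of "lead_weight ` Q"] by (metis arg_min_if_finite(1) arg_min_least)
  have "0 = mcoeff (\<Sum>\<nu>\<in>P. mps_scale (u (e_part \<nu>)) (e_part \<nu>)) (lead_monomial \<mu>)"
    using S(3) by (simp add: P sum.reindex[OF inj])
  also have "\<dots> = (\<Sum>\<nu>\<in>P. u (e_part \<nu>) * mcoeff (e_part \<nu>) (lead_monomial \<mu>))"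
    by (simp add: mcoeff_sum)
  also have "\<dots> = (\<Sum>\<nu>\<in>{\<mu>}. u (e_part \<nu>) * mcoeff (e_part \<nu>) (lead_monomial \<mu>))"
  proof (rule sum.mono_neutral_right[OF finP])
    show "{\<mu>} \<subseteq> P" using \<mu>(1) by (auto simp: Q_def)
    show "\<forall>\<nu>\<in>P - {\<mu>}. u (e_part \<nu>) * mcoeff (e_part \<nu>) (lead_monomial \<mu>) = 0"
    proof (intro ballI, rule ccontr)
      fix \<nu> assume \<nu>: "\<nu> \<in> P - {\<mu>}" "u (e_part \<nu>) * mcoeff (e_part \<nu>) (lead_monomial \<mu>) \<noteq> 0"
      then have "\<nu> \<in> Q" by (auto simp: Q_def)
      then have "lead_monomial \<mu> = lead_monomial \<nu>"
        using \<mu>(2) e_part_lead_min[of \<nu> "lead_monomial \<mu>"] \<nu> by (auto simp: sum_mset_lead)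
      with \<nu> \<mu>(1) P(1) lead_inj show False by (auto simp: Q_def dest: inj_onD)
    qed
  qed
  also have "\<dots> = u (e_part \<mu>)" by (simp add: mcoeff_e_part_lead)
  finally show False using \<mu>(1) by (simp add: Q_def)
qed

section \<open>Homogeneous symmetric functions and their coordinates\<close>

definition partitions_of :: "nat \<Rightarrow> nat multiset set" where
  "partitions_of n = {\<mu> \<in> partitions. \<Sum>\<^sub># \<mu> = n}"

text \<open>The homogeneous component of degree n of the ring of symmetric functions. Membership has
  to be carried along because \<open>e_coeff\<close> is additive only inside the span of the
  basis.\<close>

definition sym_fun :: "nat \<Rightarrow> mps set" where
  "sym_fun n = mps.span (e_part ` partitions_of n)"

lemma sym_fun_zero [simp]: "0 \<in> sym_fun n"
  and sym_fun_add: "F \<in> sym_fun n \<Longrightarrow> G \<in> sym_fun n \<Longrightarrow> F + G \<in> sym_fun n"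
  and sym_fun_diff: "F \<in> sym_fun n \<Longrightarrow> G \<in> sym_fun n \<Longrightarrow> F - G \<in> sym_fun n"
  and sym_fun_scale: "F \<in> sym_fun n \<Longrightarrow> mps_scale c F \<in> sym_fun n"
  unfolding sym_fun_def
  by (rule mps.span_zero mps.span_add mps.span_diff mps.span_scale; assumption?)+

lemma e_part_sym_fun: "\<mu> \<in> partitions_of n \<Longrightarrow> e_part \<mu> \<in> sym_fun n"
  unfolding sym_fun_def by (intro mps.span_base imageI)

lemma elem_sym_sym_fun: "k > 0 \<Longrightarrow> elem_sym k \<in> sym_fun k"
  using e_part_sym_fun[of "{#k#}" k] by (simp add: partitions_of_def partitions_def)

text \<open>The step also supplies \<open>G \<in> sym_fun n\<close>, which additivity of
  \<open>e_coeff\<close> asks for.\<close>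

lemma sym_fun_induct [consumes 1, case_names zero add]:
  assumes "F \<in> sym_fun n" "P 0" "\<And>\<mu> c G. \<mu> \<in> partitions_of n \<Longrightarrow> G \<in> sym_fun n \<Longrightarrow> P G \<Longrightarrow> P (mps_scale c (e_part \<mu>) + G)"
  shows "P F"
proof -
  have "F \<in> mps.span (e_part ` partitions_of n)" using assms(1) by (simp add: sym_fun_def)
  then have "P F \<and> F \<in> sym_fun n"
    by (induction rule: mps.span_induct_alt)
      (auto intro: assms(2,3) sym_fun_add sym_fun_scale e_part_sym_fun)
  then show ?thesis ..
qed

lemma sym_fun_times:
  assumes "F \<in> sym_fun a" "G \<in> sym_fun b"
  shows "F * G \<in> sym_fun (a + b)"
  using assms(1)
proof (induction rule: sym_fun_induct)
  case (add \<mu> c F)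
  have "e_part \<mu> * G \<in> sym_fun (a + b)"
    using assms(2)
  proof (induction rule: sym_fun_induct)
    case (add \<nu> d G)
    then show ?case using \<open>\<mu> \<in> _\<close>
      by (auto simp: distrib_left mps_scale_mult_right e_part_union[symmetric] partitions_of_def
          partitions_def intro!: sym_fun_add sym_fun_scale e_part_sym_fun)
  qed simp
  then show ?case using add by (simp add: distrib_right mps_scale_mult_left sym_fun_add sym_fun_scale)
qed simp

lemma sym_fun_subset_span: "sym_fun n \<subseteq> mps.span (e_part ` partitions)"
  unfolding sym_fun_def by (intro mps.span_mono image_mono) (auto simp: partitions_of_def)

lemma e_coeff_add: "F \<in> sym_fun n \<Longrightarrow> G \<in> sym_fun n \<Longrightarrow> e_coeff \<mu> (F + G) = e_coeff \<mu> F + e_coeff \<mu> G"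
  and e_coeff_diff: "F \<in> sym_fun n \<Longrightarrow> G \<in> sym_fun n \<Longrightarrow> e_coeff \<mu> (F - G) = e_coeff \<mu> F - e_coeff \<mu> G"
  and e_coeff_scale: "F \<in> sym_fun n \<Longrightarrow> e_coeff \<mu> (mps_scale c F) = c * e_coeff \<mu> F"
  unfolding e_coeff_def
  using sym_fun_subset_span e_part_independent
  by (simp_all add: mps.representation_add mps.representation_diff mps.representation_scale subset_iff)

lemma e_coeff_zero [simp]: "e_coeff \<mu> 0 = 0"
  by (simp add: e_coeff_def mps.representation_zero)

lemma e_coeff_e_part:
  assumes "\<mu> \<in> partitions" "\<nu> \<in> partitions"
  shows "e_coeff \<mu> (e_part \<nu>) = of_bool (\<mu> = \<nu>)"
  using assms e_part_inj
  by (auto simp: e_coeff_def mps.representation_basis[OF e_part_independent] dest: inj_onD)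

text \<open>Coordinates over the whole basis agree with those over the subfamily of degree
  \<open>n\<close>, whose span already contains \<open>F\<close>; so only partitions of
  \<open>n\<close> occur.\<close>

lemma sym_fun_expansion:
  assumes "F \<in> sym_fun n"
  obtains S where "finite S" "S \<subseteq> partitions_of n"
    "F = (\<Sum>\<mu>\<in>S. mps_scale (e_coeff \<mu> F) (e_part \<mu>))"
proof -
  have "\<exists>S. finite S \<and> S \<subseteq> partitions_of n \<and> F = (\<Sum>\<mu>\<in>S. mps_scale (e_coeff \<mu> F) (e_part \<mu>))"
  proof -
    let ?B = "e_part ` partitions_of n"
    have ext: "mps.representation (e_part ` partitions) F = mps.representation ?B F"
      by (rule mps.representation_extend[OF e_part_independent])
        (use assms in \<open>auto simp: sym_fun_def partitions_of_def\<close>)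
    have ind: "mps.independent ?B"
      by (rule mps.independent_mono[OF e_part_independent]) (auto simp: partitions_of_def)
    let ?T = "{b. mps.representation ?B F b \<noteq> 0}"
    have T: "?T \<subseteq> ?B" using mps.representation_ne_zero by blast
    then obtain S where S: "S \<subseteq> partitions_of n" "?T = e_part ` S"
      by (metis subset_image_iff)
    have inj: "inj_on e_part S" using e_part_inj by (rule inj_on_subset) (use S(1) in \<open>auto simp: partitions_of_def\<close>)
    have "finite S" using mps.finite_representation[of ?B F] S inj by (simp add: finite_image_iff)
    moreover have "F = (\<Sum>b\<in>?T. mps_scale (mps.representation ?B F b) b)"
      by (rule mps.sum_nonzero_representation_eq[OF ind, symmetric]) (use assms in \<open>simp add: sym_fun_def\<close>)
    ultimately show ?thesis using S(1)
      by (auto simp: S(2) sum.reindex[OF inj] e_coeff_def ext intro!: exI[of _ S])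
  qed
  then show ?thesis using that by blast
qed

text \<open>A product of two basis elements of positive degree belongs to a partition with at least
  two parts. This is what annihilates disconnected graphs and the product term in the hook
  recursion.\<close>

lemma e_coeff_times:
  assumes "F \<in> sym_fun a" "G \<in> sym_fun b" "a > 0" "b > 0" "n > 0"
  shows "e_coeff {#n#} (F * G) = 0"
  using assms(1)
proof (induction rule: sym_fun_induct)
    case (add \<mu> c F)
    have "e_coeff {#n#} (e_part \<mu> * G) = 0"
      using assms(2)
    proof (induction rule: sym_fun_induct)
      case (add \<nu> d G)
      have ne: "\<mu> \<noteq> {#}" "\<nu> \<noteq> {#}" using \<open>\<mu> \<in> _\<close> \<open>\<nu> \<in> _\<close> assms by (auto simp: partitions_of_def)
      have p: "\<mu> + \<nu> \<in> partitions_of (a + b)"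
        using \<open>\<mu> \<in> _\<close> \<open>\<nu> \<in> _\<close> by (auto simp: partitions_of_def partitions_def)
      have "\<mu> + \<nu> \<noteq> {#n#}" using ne by (metis add_eq_conv_diff add.right_neutral union_is_single)
      then have "e_coeff {#n#} (e_part (\<mu> + \<nu>)) = 0"
        using p assms by (subst e_coeff_e_part) (auto simp: partitions_def partitions_of_def)
      moreover have "e_part \<mu> * G \<in> sym_fun (a + b)"
        using \<open>\<mu> \<in> _\<close> add by (intro sym_fun_times e_part_sym_fun)
      ultimately show ?case using add p
        by (simp add: distrib_left mps_scale_mult_right e_part_union[symmetric]
            e_coeff_add[of _ "a + b"] e_coeff_scale[of _ "a + b"] sym_fun_scale e_part_sym_fun)
    qed simp
    moreover have "e_part \<mu> * G \<in> sym_fun (a + b)" "F * G \<in> sym_fun (a + b)"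
      using add assms by (auto intro: sym_fun_times e_part_sym_fun)
    ultimately show ?case using add
      by (simp add: distrib_right mps_scale_mult_left e_coeff_add[of _ "a + b"] e_coeff_scale[of _ "a + b"] sym_fun_scale)
qed simp

section \<open>Power sums\<close>

definition power_sum :: "nat \<Rightarrow> mps" where
  "power_sum s = Abs_mps (\<lambda>m. of_bool (\<exists>i. m = replicate_mset s i))"

text \<open>
  For s > 1 this is the monomial symmetric function of the hook (s, 1, ..., 1) with r ones; for s = 1
  each monomial is counted once per variable, which makes \<open>elem_sym_times_power_sum\<close> uniform.
\<close>

definition hook_sum :: "nat \<Rightarrow> nat \<Rightarrow> mps" where
  "hook_sum r s = Abs_mps (\<lambda>m. of_nat (card {i. size m = r + s \<and> count m i = s \<and> (\<forall>j. j \<noteq> i \<longrightarrow> count m j \<le> 1)}))"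

lemma mcoeff_power_sum [simp]: "mcoeff (power_sum s) m = of_bool (\<exists>i. m = replicate_mset s i)"
  and mcoeff_hook_sum [simp]: "mcoeff (hook_sum r s) m =
    of_nat (card {i. size m = r + s \<and> count m i = s \<and> (\<forall>j. j \<noteq> i \<longrightarrow> count m j \<le> 1)})"
  by (simp_all add: power_sum_def hook_sum_def Abs_mps_inverse)

lemma finite_count_eq: "s > 0 \<Longrightarrow> finite {i. P i \<and> count m i = s \<and> Q i}"
  by (rule finite_subset[of _ "set_mset m"]) (auto simp flip: count_greater_zero_iff)

lemma hook_sum_1: "hook_sum r 1 = mps_scale (of_nat (Suc r)) (elem_sym (Suc r))"
proof (rule mps_eqI)
  fix m :: "nat multiset"
  have "{i. size m = r + 1 \<and> count m i = 1 \<and> (\<forall>j. j \<noteq> i \<longrightarrow> count m j \<le> 1)} =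
    (if size m = Suc r \<and> (\<forall>i. count m i \<le> 1) then set_mset m else {})" (is "?S = _")
  proof -
    have A: "\<forall>i. count m i \<le> 1" if "count m k = 1" "\<forall>j. j \<noteq> k \<longrightarrow> count m j \<le> 1" for k
      using that by (metis order_refl)
    have B: "count m i = 1 \<longleftrightarrow> i \<in># m" if "\<forall>i. count m i \<le> 1" for i
      using that[rule_format, of i] by (auto simp flip: count_greater_zero_iff)
    show ?thesis
    proof (cases "size m = Suc r \<and> (\<forall>i. count m i \<le> 1)")
      case True
      then have "?S = {i. count m i = 1}" by auto
      also have "\<dots> = set_mset m" using B True by blast
      finally show ?thesis using True by simp
    next
      case False
      show ?thesis unfolding if_not_P[OF False] using A False by auto
    qed
  qed
  moreover have "card (set_mset m) = size m" if "\<forall>i. count m i \<le> 1"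
    using arg_cong[OF squarefree_eq_mset_set[of m], of size] that by simp
  ultimately show "mcoeff (hook_sum r 1) m = mcoeff (mps_scale (of_nat (Suc r)) (elem_sym (Suc r))) m"
    by simp
qed

lemma hook_sum_0:
  assumes "s > 0" shows "hook_sum 0 s = power_sum s"
proof (rule mps_eqI)
  fix m :: "nat multiset"
  have rep: "m = replicate_mset s i" if "size m = s" "count m i = s" for i
  proof -
    have "replicate_mset s i \<subseteq># m" using that by (simp flip: count_le_replicate_mset_subset_eq)
    then show ?thesis using that by (metis mset_subset_size nless_le size_replicate_mset subset_mset.le_less)
  qed
  show "mcoeff (hook_sum 0 s) m = mcoeff (power_sum s) m"
  proof (cases "\<exists>i. m = replicate_mset s i")
    case True
    then obtain i where i: "m = replicate_mset s i" by blast
    then have "{k. size m = 0 + s \<and> count m k = s \<and> (\<forall>j. j \<noteq> k \<longrightarrow> count m j \<le> 1)} = {i}"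
      using assms by auto
    then show ?thesis using True by simp
  next
    case False
    then have E: "{k. size m = 0 + s \<and> count m k = s \<and> (\<forall>j. j \<noteq> k \<longrightarrow> count m j \<le> 1)} = {}"
      using rep by auto
    show ?thesis unfolding mcoeff_hook_sum E using False by simp
  qed
qed

text \<open>In a product of a squarefree monomial with the s-th power of variable i, that variable
  is either absent from the first factor (final exponent s) or present (exponent s + 1). A splitting
  of \<open>m\<close> is determined by i, which can be read off from its power because
  \<open>s > 0\<close>.\<close>

lemma elem_sym_times_power_sum:
  assumes "s > 0"
  shows "elem_sym (Suc r) * power_sum s = hook_sum (Suc r) s + hook_sum r (Suc s)"
proof (rule mps_eqI)
  fix m :: "nat multiset"
  let ?A = "{i. size m = Suc r + s \<and> count m i = s \<and> (\<forall>j. j \<noteq> i \<longrightarrow> count m j \<le> 1)}"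
  let ?B = "{i. size m = r + Suc s \<and> count m i = Suc s \<and> (\<forall>j. j \<noteq> i \<longrightarrow> count m j \<le> 1)}"
  let ?P = "\<lambda>(a, b). size a = Suc r \<and> (\<forall>i. count a i \<le> 1) \<and> (\<exists>i. b = replicate_mset s i)"
  let ?f = "\<lambda>i. (m - replicate_mset s i, replicate_mset s i)"
  have "{(a, b). a + b = m} \<inter> {x. ?P x} = ?f ` (?A \<union> ?B)"
  proof (intro equalityI subsetI)
    fix x assume "x \<in> {(a, b). a + b = m} \<inter> {x. ?P x}"
    then obtain a i where x: "x = (a, replicate_mset s i)" "a + replicate_mset s i = m"
      "size a = Suc r" "\<And>i. count a i \<le> 1" by auto
    have "count m j \<le> 1" if "j \<noteq> i" for j using x(2) x(4)[of j] that by auto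
    moreover have "count m i = s \<or> count m i = Suc s" using x(2) x(4)[of i] by auto
    moreover have "size m = Suc r + s" using x(2,3) by auto
    ultimately have "i \<in> ?A \<union> ?B" by auto
    moreover have "x = ?f i" using x by auto
    ultimately show "x \<in> ?f ` (?A \<union> ?B)" by blast
  next
    fix x assume "x \<in> ?f ` (?A \<union> ?B)"
    then obtain i where i: "x = ?f i" "i \<in> ?A \<union> ?B" by blast
    then have sub: "replicate_mset s i \<subseteq># m" by (auto simp flip: count_le_replicate_mset_subset_eq)
    moreover have "count (m - replicate_mset s i) j \<le> 1" for j using i(2) by (cases "j = i") auto
    ultimately show "x \<in> {(a, b). a + b = m} \<inter> {x. ?P x}"
      using i by (auto simp: size_Diff_submset)
  qed
  moreover have "inj_on ?f X" for X
    using assms by (intro inj_onI) (metis Pair_inject in_replicate_mset less_nat_zero_code not_gr_zero)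
  moreover have "finite ?A" "finite ?B" using assms by (auto intro!: finite_count_eq)
  moreover have "?A \<inter> ?B = {}" by auto
  ultimately have "card ({(a, b). a + b = m} \<inter> {x. ?P x}) = card ?A + card ?B"
    by (simp add: card_image card_Un_disjoint)
  moreover have "mcoeff (elem_sym (Suc r) * power_sum s) m = (\<Sum>x | x \<in> {(a, b). a + b = m}. of_bool (?P x))"
    by (simp add: mcoeff_times case_prod_beta' of_bool_conj[symmetric])
  ultimately show "mcoeff (elem_sym (Suc r) * power_sum s) m =
      mcoeff (hook_sum (Suc r) s + hook_sum r (Suc s)) m"
    using finite_msplit[of m] by (simp add: sum_of_bool_eq)
qed

lemma hook_sum_step:
  assumes "s > 0"
  shows "hook_sum r (Suc s) = elem_sym (Suc r) * power_sum s - hook_sum (Suc r) s"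
  using elem_sym_times_power_sum[OF assms, of r] by simp

text \<open>The recursion lowers \<open>s\<close> while raising \<open>r\<close>, down to multiples
  of elementary functions; hence \<open>r\<close> is arbitrary. The power sum in it is the hook with
  \<open>r = 0\<close>, so it is covered by the same induction hypothesis.\<close>

lemma hook_sum_sym_fun: "s > 0 \<Longrightarrow> hook_sum r s \<in> sym_fun (r + s)"
proof (induction s arbitrary: r rule: nat_induct_non_zero)
  case 1
  show ?case using hook_sum_1[of r] elem_sym_sym_fun[of "Suc r"] by (simp add: sym_fun_scale)
next
  case (Suc s)
  have "elem_sym (Suc r) * power_sum s \<in> sym_fun (Suc r + s)"
    using Suc.IH[of 0] Suc.hyps by (intro sym_fun_times elem_sym_sym_fun) (auto simp: hook_sum_0)
  then show ?case using Suc.IH[of "Suc r"] Suc.hyps by (simp add: hook_sum_step sym_fun_diff)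
qed

lemma power_sum_sym_fun: "s > 0 \<Longrightarrow> power_sum s \<in> sym_fun s"
  using hook_sum_sym_fun[of s 0] by (simp add: hook_sum_0)

text \<open>The product in the recursion has no top coefficient, so each step merely flips the sign,
  starting from the factor \<open>Suc r\<close> in \<open>hook_sum_1\<close>.\<close>

lemma e_coeff_hook_sum: "s > 0 \<Longrightarrow> e_coeff {#r + s#} (hook_sum r s) = (-1) ^ (s - 1) * of_nat (r + s)"
proof (induction s arbitrary: r rule: nat_induct_non_zero)
  case 1
  have "e_coeff {#Suc r#} (elem_sym (Suc r)) = 1"
    using e_coeff_e_part[of "{#Suc r#}" "{#Suc r#}"] by (simp add: partitions_def)
  then show ?case using hook_sum_1[of r] e_coeff_scale[OF elem_sym_sym_fun[of "Suc r"]] by simp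
next
  case (Suc s)
  have p: "power_sum s \<in> sym_fun s" and e: "elem_sym (Suc r) \<in> sym_fun (Suc r)"
    using Suc.hyps by (auto intro: power_sum_sym_fun elem_sym_sym_fun)
  have "e_coeff {#r + Suc s#} (hook_sum r (Suc s)) =
      e_coeff {#Suc r + s#} (elem_sym (Suc r) * power_sum s) - e_coeff {#Suc r + s#} (hook_sum (Suc r) s)"
    using Suc.hyps hook_sum_sym_fun[of s "Suc r"] sym_fun_times[OF e p]
    by (simp add: hook_sum_step e_coeff_diff[of _ "Suc (r + s)"])
  also have "e_coeff {#Suc r + s#} (elem_sym (Suc r) * power_sum s) = 0"
    by (rule e_coeff_times[OF e p]) (use Suc.hyps in auto)
  finally show ?case using Suc.IH[of "Suc r"] Suc.hyps by (cases s) auto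
qed

lemma e_coeff_power_sum: "n > 0 \<Longrightarrow> e_coeff {#n#} (power_sum n) = (-1) ^ (n - 1) * of_nat n"
  using e_coeff_hook_sum[of n 0] by (simp add: hook_sum_0)

section \<open>Colourings of contracted graphs\<close>

text \<open>
  Contracted edges are recorded by the map \<^term>\<open>\<pi>\<close> instead of changing the vertex set: vertices with
  the same image are identified, hence receive the same colour.
\<close>

definition blown_colourings :: "'a set \<Rightarrow> 'a rel \<Rightarrow> ('a \<Rightarrow> 'a) \<Rightarrow> ('a \<Rightarrow> nat) set" where
  "blown_colourings V E \<pi> = {\<kappa> \<in> V \<rightarrow>\<^sub>E UNIV. (\<forall>u v. (u, v) \<in> E \<longrightarrow> \<kappa> u \<noteq> \<kappa> v) \<and>
     (\<forall>u\<in>V. \<forall>v\<in>V. \<pi> u = \<pi> v \<longrightarrow> \<kappa> u = \<kappa> v)}"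

definition colouring_series :: "'a set \<Rightarrow> 'a rel \<Rightarrow> ('a \<Rightarrow> 'a) \<Rightarrow> mps" where
  "colouring_series V E \<pi> =
     Abs_mps (\<lambda>m. of_nat (card {\<kappa> \<in> blown_colourings V E \<pi>. image_mset \<kappa> (mset_set V) = m}))"

definition merge :: "('a \<Rightarrow> 'a) \<Rightarrow> 'a \<Rightarrow> 'a \<Rightarrow> 'a \<Rightarrow> 'a" where
  "merge \<pi> u v = (\<lambda>x. if \<pi> x = \<pi> v then \<pi> u else \<pi> x)"

lemma mcoeff_colouring_series:
  "mcoeff (colouring_series V E \<pi>) m =
     of_nat (card {\<kappa> \<in> blown_colourings V E \<pi>. image_mset \<kappa> (mset_set V) = m})"
  by (simp add: colouring_series_def Abs_mps_inverse)

text \<open>Only colours occurring in \<open>m\<close> can be used. Finiteness matters because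
  \<open>card\<close> is 0 on infinite sets.\<close>

lemma finite_blown_colourings:
  assumes "finite V"
  shows "finite {\<kappa> \<in> blown_colourings V E \<pi>. image_mset \<kappa> (mset_set V) = m}"
proof (rule finite_subset)
  show "{\<kappa> \<in> blown_colourings V E \<pi>. image_mset \<kappa> (mset_set V) = m} \<subseteq> V \<rightarrow>\<^sub>E set_mset m"
  proof
    fix \<kappa> assume k: "\<kappa> \<in> {\<kappa> \<in> blown_colourings V E \<pi>. image_mset \<kappa> (mset_set V) = m}"
    then have "\<kappa> ` V = set_mset m"
      using assms by (metis (mono_tags, lifting) finite_set_mset_mset_set mem_Collect_eq set_image_mset)
    moreover have "\<kappa> \<in> V \<rightarrow>\<^sub>E UNIV" using k by (simp add: blown_colourings_def)
    ultimately show "\<kappa> \<in> V \<rightarrow>\<^sub>E set_mset m" by (auto simp: PiE_iff)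
  qed
  show "finite (V \<rightarrow>\<^sub>E set_mset m)" using assms by (auto intro: finite_PiE)
qed

lemma blown_colourings_extensional: "\<kappa> \<in> blown_colourings V E \<pi> \<Longrightarrow> \<kappa> \<in> extensional V"
  unfolding blown_colourings_def PiE_def by blast

lemma blown_colourings_restrict:
  assumes "\<kappa> \<in> blown_colourings V E \<pi>" "A \<subseteq> V"
  shows "restrict \<kappa> A \<in> blown_colourings A (E \<inter> A \<times> A) \<pi>"
proof -
  have "\<kappa> u \<noteq> \<kappa> v" if "(u, v) \<in> E" for u v
    using assms that unfolding blown_colourings_def by blast
  moreover have "\<kappa> u = \<kappa> v" if "u \<in> A" "v \<in> A" "\<pi> u = \<pi> v" for u v
    using assms that unfolding blown_colourings_def by blast
  ultimately have
    "\<forall>u v. (u, v) \<in> E \<inter> A \<times> A \<longrightarrow> restrict \<kappa> A u \<noteq> restrict \<kappa> A v"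
    "\<forall>u\<in>A. \<forall>v\<in>A. \<pi> u = \<pi> v \<longrightarrow> restrict \<kappa> A u = restrict \<kappa> A v"
    by (metis IntD1 IntD2 mem_Sigma_iff restrict_apply', metis restrict_apply')
  moreover have "restrict \<kappa> A \<in> A \<rightarrow>\<^sub>E UNIV" by simp
  ultimately show ?thesis unfolding blown_colourings_def by blast
qed

lemma chromatic_sym_eq: "chromatic_sym G = colouring_series (pverts G) (parcs G) (\<lambda>x. x)"
  by (rule mps_eqI) (simp add: mcoeff_colouring_series chromatic_sym.rep_eq proper_colourings_def blown_colourings_def
      Ball_def)

text \<open>Allows a graph to be given by one arc per edge, so that a tree has fewer arcs than
  vertices.\<close>

lemma colouring_series_symcl: "colouring_series V (E \<union> E\<inverse>) \<pi> = colouring_series V E \<pi>"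
proof -
  have "(\<forall>u v. (u, v) \<in> E \<union> E\<inverse> \<longrightarrow> \<kappa> u \<noteq> \<kappa> v) \<longleftrightarrow> (\<forall>u v. (u, v) \<in> E \<longrightarrow> \<kappa> u \<noteq> \<kappa> v)" for \<kappa> :: "_ \<Rightarrow> nat"
    by (metis Un_iff converse_iff)
  then have "blown_colourings V (E \<union> E\<inverse>) \<pi> = blown_colourings V E \<pi>"
    by (simp only: blown_colourings_def)
  then show ?thesis by (simp add: colouring_series_def)
qed

lemma colouring_series_loop:
  assumes "(u, v) \<in> E" "u \<in> V" "v \<in> V" "\<pi> u = \<pi> v"
  shows "colouring_series V E \<pi> = 0"
proof -
  have "blown_colourings V E \<pi> = {}" using assms by (fastforce simp: blown_colourings_def)
  then show ?thesis by (auto intro!: mps_eqI simp: mcoeff_colouring_series)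
qed

text \<open>The labels chosen by \<open>merge\<close> are asymmetric in \<open>u\<close> and
  \<open>v\<close>, but only its fibres matter, and these are symmetric.\<close>

lemma merge_eq_iff:
  "merge \<pi> u v x = merge \<pi> u v y \<longleftrightarrow>
     \<pi> x = \<pi> y \<or> (\<pi> x = \<pi> u \<and> \<pi> y = \<pi> v) \<or> (\<pi> x = \<pi> v \<and> \<pi> y = \<pi> u)"
  by (auto simp: merge_def)

text \<open>Colourings without the constraint from \<open>(u, v)\<close> are sorted by whether
  \<open>u\<close> and \<open>v\<close> receive different or equal colours. Since \<open>V\<close>
  is kept, both kinds contribute to the same monomial \<open>m\<close>.\<close>

lemma deletion_contraction:
  assumes V: "finite V" and e: "(u, v) \<in> E" "u \<in> V" "v \<in> V"
  shows "colouring_series V E \<pi> =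
    colouring_series V (E - {(u, v)}) \<pi> - colouring_series V (E - {(u, v)}) (merge \<pi> u v)"
proof (rule mps_eqI)
  fix m
  let ?C = "\<lambda>E \<pi>. {\<kappa> \<in> blown_colourings V E \<pi>. image_mset \<kappa> (mset_set V) = m}"
  have "blown_colourings V (E - {(u, v)}) \<pi> = blown_colourings V E \<pi> \<union> blown_colourings V (E - {(u, v)}) (merge \<pi> u v)"
  proof (intro equalityI subsetI)
    fix \<kappa> assume k: "\<kappa> \<in> blown_colourings V (E - {(u, v)}) \<pi>"
    show "\<kappa> \<in> blown_colourings V E \<pi> \<union> blown_colourings V (E - {(u, v)}) (merge \<pi> u v)"
    proof (cases "\<kappa> u = \<kappa> v")
      case True
      have "\<kappa> x = \<kappa> y" if "merge \<pi> u v x = merge \<pi> u v y" "x \<in> V" "y \<in> V" for x y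
        using k that True e(2,3) unfolding merge_eq_iff blown_colourings_def mem_Collect_eq by metis
      then have "\<kappa> \<in> blown_colourings V (E - {(u, v)}) (merge \<pi> u v)"
        using k unfolding blown_colourings_def mem_Collect_eq by blast
      then show ?thesis by blast
    next
      case False
      then show ?thesis using k unfolding blown_colourings_def mem_Collect_eq by blast
    qed
  next
    fix \<kappa> assume "\<kappa> \<in> blown_colourings V E \<pi> \<union> blown_colourings V (E - {(u, v)}) (merge \<pi> u v)"
    then show "\<kappa> \<in> blown_colourings V (E - {(u, v)}) \<pi>"
      unfolding blown_colourings_def mem_Collect_eq merge_eq_iff by blast
  qed
  moreover have "blown_colourings V E \<pi> \<inter> blown_colourings V (E - {(u, v)}) (merge \<pi> u v) = {}"
    using e unfolding blown_colourings_def merge_eq_iff by blast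
  ultimately have "?C (E - {(u, v)}) \<pi> = ?C E \<pi> \<union> ?C (E - {(u, v)}) (merge \<pi> u v)"
    "?C E \<pi> \<inter> ?C (E - {(u, v)}) (merge \<pi> u v) = {}" by auto
  then have "card (?C (E - {(u, v)}) \<pi>) = card (?C E \<pi>) + card (?C (E - {(u, v)}) (merge \<pi> u v))"
    by (simp add: card_Un_disjoint finite_blown_colourings V)
  then show "mcoeff (colouring_series V E \<pi>) m =
    mcoeff (colouring_series V (E - {(u, v)}) \<pi> - colouring_series V (E - {(u, v)}) (merge \<pi> u v)) m"
    by (simp add: mcoeff_colouring_series)
qed

lemma colouring_series_disjoint_union:
  assumes fin: "finite A" "finite B" and AB: "A \<inter> B = {}"
    and E: "E \<subseteq> A \<times> A \<union> B \<times> B" and \<pi>: "\<pi> ` A \<inter> \<pi> ` B = {}"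
  shows "colouring_series (A \<union> B) E \<pi> =
    colouring_series A (E \<inter> A \<times> A) \<pi> * colouring_series B (E \<inter> B \<times> B) \<pi>"
proof (rule mps_eqI)
  fix m
  let ?C = "\<lambda>V E m. {\<kappa> \<in> blown_colourings V E \<pi>. image_mset \<kappa> (mset_set V) = m}"
  let ?E1 = "E \<inter> A \<times> A" and ?E2 = "E \<inter> B \<times> B"
  \<comment> \<open>\<open>S\<close> groups the pairs of colourings by the way their monomials split
    \<open>m\<close>, as the product of series does; \<open>T\<close> is the ungrouped set of pairs,
    which is what restriction to the two sides produces.\<close>
  define S where "S = (SIGMA (a, b) : {(a, b). a + b = m}. ?C A ?E1 a \<times> ?C B ?E2 b)"
  define T where "T = {(\<kappa>, \<mu>). \<kappa> \<in> blown_colourings A ?E1 \<pi> \<and> \<mu> \<in> blown_colourings B ?E2 \<pi> \<and>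
    image_mset \<kappa> (mset_set A) + image_mset \<mu> (mset_set B) = m}"
  have ST: "card S = card T"
    by (rule bij_betw_same_card[of snd], rule bij_betw_byWitness[where f' = "\<lambda>(\<kappa>, \<mu>).
        ((image_mset \<kappa> (mset_set A), image_mset \<mu> (mset_set B)), (\<kappa>, \<mu>))"]) (auto simp: S_def T_def)
  have "bij_betw (\<lambda>\<kappa>. (restrict \<kappa> A, restrict \<kappa> B)) (?C (A \<union> B) E m) T"
  proof (rule bij_betw_byWitness[where f' = "\<lambda>(\<kappa>, \<mu>). (\<lambda>x. if x \<in> A then \<kappa> x else \<mu> x)"])
    have ms: "image_mset \<kappa> (mset_set (A \<union> B)) = image_mset (restrict \<kappa> A) (mset_set A) + image_mset (restrict \<kappa> B) (mset_set B)"
      for \<kappa> :: "_ \<Rightarrow> nat"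
    proof -
      have "image_mset (restrict \<kappa> X) (mset_set X) = image_mset \<kappa> (mset_set X)" if "finite X" for X
        using that by (intro image_mset_cong) simp
      then show ?thesis using fin AB by (simp add: mset_set_Union)
    qed
    have r: "restrict (\<lambda>x. if x \<in> A then \<kappa> x else \<mu> x) A = \<kappa>" "restrict (\<lambda>x. if x \<in> A then \<kappa> x else \<mu> x) B = \<mu>"
      if "(\<kappa>, \<mu>) \<in> T" for \<kappa> \<mu>
    proof -
      have "\<kappa> \<in> blown_colourings A ?E1 \<pi>" "\<mu> \<in> blown_colourings B ?E2 \<pi>"
        using that unfolding T_def by blast+
      then have ext: "\<kappa> \<in> extensional A" "\<mu> \<in> extensional B"
        by (auto intro: blown_colourings_extensional)
      show "restrict (\<lambda>x. if x \<in> A then \<kappa> x else \<mu> x) A = \<kappa>"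
        by (rule extensionalityI[OF _ ext(1)]) auto
      show "restrict (\<lambda>x. if x \<in> A then \<kappa> x else \<mu> x) B = \<mu>"
        by (rule extensionalityI[OF _ ext(2)]) (use AB in auto)
    qed
    show "\<forall>\<kappa>\<in>?C (A \<union> B) E m. (case (restrict \<kappa> A, restrict \<kappa> B) of (\<kappa>, \<mu>) \<Rightarrow> \<lambda>x. if x \<in> A then \<kappa> x else \<mu> x) = \<kappa>"
      by (auto dest!: blown_colourings_extensional simp: fun_eq_iff extensional_def)
    show "\<forall>p\<in>T. (\<lambda>\<kappa>. (restrict \<kappa> A, restrict \<kappa> B)) (case p of (\<kappa>, \<mu>) \<Rightarrow> (\<lambda>x. if x \<in> A then \<kappa> x else \<mu> x)) = p"
      using r by (auto simp del: restrict_apply)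
    show "(\<lambda>\<kappa>. (restrict \<kappa> A, restrict \<kappa> B)) ` ?C (A \<union> B) E m \<subseteq> T"
    proof (rule image_subsetI)
      fix \<kappa> assume k: "\<kappa> \<in> ?C (A \<union> B) E m"
      then have "restrict \<kappa> A \<in> blown_colourings A ?E1 \<pi>" "restrict \<kappa> B \<in> blown_colourings B ?E2 \<pi>"
        by (auto intro!: blown_colourings_restrict simp del: restrict_apply)
      then show "(restrict \<kappa> A, restrict \<kappa> B) \<in> T" using k unfolding T_def ms by blast
    qed
    show "(\<lambda>(\<kappa>, \<mu>) x. if x \<in> A then \<kappa> x else \<mu> x) ` T \<subseteq> ?C (A \<union> B) E m"
    proof (rule image_subsetI)
      fix p assume p: "p \<in> T"
      obtain \<kappa> \<mu> where p_eq: "p = (\<kappa>, \<mu>)" by (cases p)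
      have t: "(\<kappa>, \<mu>) \<in> T" using p p_eq by simp
      let ?k = "\<lambda>x. if x \<in> A then \<kappa> x else \<mu> x"
      have k: "\<kappa> \<in> blown_colourings A ?E1 \<pi>" "\<mu> \<in> blown_colourings B ?E2 \<pi>"
        using t unfolding T_def by blast+
      have "?k u \<noteq> ?k v" if uv: "(u, v) \<in> E" for u v
      proof -
        have "(u, v) \<in> A \<times> A \<union> B \<times> B" using E uv by (rule subsetD)
        then consider "u \<in> A" "v \<in> A" | "u \<in> B" "v \<in> B" "u \<notin> A" "v \<notin> A" using AB by auto
        then show ?thesis
        proof cases
          case 1
          then have "(u, v) \<in> ?E1" using uv by simp
          then have "\<kappa> u \<noteq> \<kappa> v" using k(1) unfolding blown_colourings_def by blast
          with 1 show ?thesis by simp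
        next
          case 2
          then have "(u, v) \<in> ?E2" using uv by simp
          then have "\<mu> u \<noteq> \<mu> v" using k(2) unfolding blown_colourings_def by blast
          with 2 show ?thesis by simp
        qed
      qed
      moreover have "?k u = ?k v" if u: "u \<in> A \<union> B" and v: "v \<in> A \<union> B" and uv: "\<pi> u = \<pi> v" for u v
      proof -
        have "\<not> (u \<in> A \<and> v \<in> B)" "\<not> (u \<in> B \<and> v \<in> A)" using \<pi> uv by (metis disjoint_iff imageI)+
        then consider "u \<in> A" "v \<in> A" | "u \<in> B" "v \<in> B" "u \<notin> A" "v \<notin> A" using u v by blast
        then show ?thesis
        proof cases
          case 1
          then have "\<kappa> u = \<kappa> v" using k(1) uv unfolding blown_colourings_def by blast
          with 1 show ?thesis by simp
        next
          case 2
          then have "\<mu> u = \<mu> v" using k(2) uv unfolding blown_colourings_def by blast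
          with 2 show ?thesis by simp
        qed
      qed
      moreover have "?k \<in> A \<union> B \<rightarrow>\<^sub>E UNIV"
        using k[THEN blown_colourings_extensional] by (auto simp: PiE_def extensional_def)
      ultimately have "?k \<in> blown_colourings (A \<union> B) E \<pi>" unfolding blown_colourings_def by blast
      moreover have "image_mset ?k (mset_set (A \<union> B)) = m"
        unfolding ms r[OF t] using t by (simp add: T_def)
      ultimately show "(case p of (\<kappa>, \<mu>) \<Rightarrow> \<lambda>x. if x \<in> A then \<kappa> x else \<mu> x) \<in> ?C (A \<union> B) E m"
        unfolding p_eq by simp
    qed
  qed
  from bij_betw_same_card[OF this] have "card (?C (A \<union> B) E m) = card S"
    by (simp only: ST)
  also have "card S = (\<Sum>x\<in>{(a, b). a + b = m}. card (case x of (a, b) \<Rightarrow> ?C A ?E1 a \<times> ?C B ?E2 b))"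
    unfolding S_def using fin
    by (intro card_SigmaI finite_msplit ballI)
      (simp add: case_prod_beta' finite_blown_colourings)
  finally show "mcoeff (colouring_series (A \<union> B) E \<pi>) m =
    mcoeff (colouring_series A ?E1 \<pi> * colouring_series B ?E2 \<pi>) m"
    by (simp add: mcoeff_times mcoeff_colouring_series case_prod_beta' card_cartesian_product)
qed

lemma colouring_series_single_block:
  assumes "finite V" "v \<in> V" "\<And>u. u \<in> V \<Longrightarrow> \<pi> u = \<pi> v"
  shows "colouring_series V {} \<pi> = power_sum (card V)"
proof (rule mps_eqI)
  fix m
  have V: "card V > 0" using assms by (auto simp: card_gt_0_iff)
  have k: "blown_colourings V {} \<pi> = range (\<lambda>i. \<lambda>x\<in>V. i)"
  proof (intro equalityI subsetI)
    fix \<kappa> assume "\<kappa> \<in> blown_colourings V {} \<pi>"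
    moreover from this have "\<kappa> u = \<kappa> v" if "u \<in> V" for u
      using assms(2) assms(3)[OF that] that unfolding blown_colourings_def by blast
    ultimately have "\<kappa> = (\<lambda>x\<in>V. \<kappa> v)"
      by (auto simp: blown_colourings_def fun_eq_iff PiE_def extensional_def)
    then show "\<kappa> \<in> range (\<lambda>i. \<lambda>x\<in>V. i)" by blast
  qed (auto simp: blown_colourings_def)
  have "image_mset (\<lambda>x\<in>V. i) (mset_set V) = replicate_mset (card V) i" for i :: nat
  proof -
    have "image_mset (\<lambda>x\<in>V. i) (mset_set V) = image_mset (\<lambda>_. i) (mset_set V)"
      using assms(1) by (intro image_mset_cong) simp
    then show ?thesis by (simp add: image_mset_const_eq)
  qed
  then have eq: "{\<kappa> \<in> blown_colourings V {} \<pi>. image_mset \<kappa> (mset_set V) = m} =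
     (\<lambda>i. \<lambda>x\<in>V. i) ` {i. m = replicate_mset (card V) i}"
    unfolding k by auto
  show "mcoeff (colouring_series V {} \<pi>) m = mcoeff (power_sum (card V)) m"
  proof (cases "\<exists>i. m = replicate_mset (card V) i")
    case True
    then obtain i where i: "m = replicate_mset (card V) i" by blast
    \<comment> \<open>A nonempty \<open>V\<close> makes the colour recoverable from its
      power.\<close>
    then have "{i. m = replicate_mset (card V) i} = {i}" using V
      by auto (metis count_replicate_mset less_numeral_extra(3))
    then show ?thesis using True by (simp add: mcoeff_colouring_series eq)
  next
    case False
    then show ?thesis by (simp add: mcoeff_colouring_series eq)
  qed
qed

section \<open>The top coefficient\<close>

text \<open>Connectedness of the contracted graph, phrased by cuts so that no paths are needed.\<close>

definition cut_connected :: "'a set \<Rightarrow> 'a rel \<Rightarrow> ('a \<Rightarrow> 'a) \<Rightarrow> bool" where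
  "cut_connected V E \<pi> \<longleftrightarrow> (\<forall>A. A \<subseteq> V \<longrightarrow> A \<noteq> {} \<longrightarrow> A \<noteq> V \<longrightarrow>
     (\<exists>u\<in>A. \<exists>v\<in>V - A. (u, v) \<in> E \<or> (v, u) \<in> E \<or> \<pi> u = \<pi> v))"

lemma cut_connectedE:
  assumes "cut_connected V E \<pi>" "A \<subseteq> V" "A \<noteq> {}" "A \<noteq> V"
  obtains u v where "u \<in> A" "v \<in> V - A" "(u, v) \<in> E \<or> (v, u) \<in> E \<or> \<pi> u = \<pi> v"
  using assms(1)[unfolded cut_connected_def, rule_format, OF assms(2-4)] that by blast

text \<open>A set violating connectedness and its complement share neither arcs nor blocks, so the
  graph is a disjoint union.\<close>

lemma not_cut_connected_split:
  assumes "finite V" "E \<subseteq> V \<times> V" "\<not> cut_connected V E \<pi>"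
  obtains A B where "A \<noteq> {}" "B \<noteq> {}" "A \<subset> V" "B \<subset> V" "card A + card B = card V"
    "colouring_series V E \<pi> = colouring_series A (E \<inter> A \<times> A) \<pi> * colouring_series B (E \<inter> B \<times> B) \<pi>"
proof -
  obtain A where A: "A \<subseteq> V" "A \<noteq> {}" "A \<noteq> V"
    and no: "\<And>u v. u \<in> A \<Longrightarrow> v \<in> V - A \<Longrightarrow> (u, v) \<notin> E \<and> (v, u) \<notin> E \<and> \<pi> u \<noteq> \<pi> v"
    using assms(3) unfolding cut_connected_def by blast
  let ?B = "V - A"
  have V: "V = A \<union> ?B" using A by blast
  have fin: "finite A" "finite ?B" using assms(1) A finite_subset by auto
  have "E \<subseteq> A \<times> A \<union> ?B \<times> ?B"
  proof
    fix e assume e: "e \<in> E"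
    obtain u v where uv: "e = (u, v)" by (cases e)
    then have "u \<in> V" "v \<in> V" using e assms(2) by auto
    then show "e \<in> A \<times> A \<union> ?B \<times> ?B" using no[of u v] no[of v u] e uv by auto
  qed
  moreover have "\<pi> ` A \<inter> \<pi> ` ?B = {}" using no by blast
  ultimately have "colouring_series V E \<pi> =
      colouring_series A (E \<inter> A \<times> A) \<pi> * colouring_series ?B (E \<inter> ?B \<times> ?B) \<pi>"
    using colouring_series_disjoint_union[OF fin, of E \<pi>] V by auto
  moreover have "card A + card ?B = card V"
    using card_Un_disjoint[OF fin] V by (metis Diff_disjoint)
  ultimately show ?thesis using that[of A ?B] A by blast
qed

lemma cut_connected_no_edges:
  assumes "cut_connected V {} \<pi>" "u \<in> V" "v \<in> V"
  shows "\<pi> u = \<pi> v"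
proof (rule ccontr)
  assume ne: "\<pi> u \<noteq> \<pi> v"
  \<comment> \<open>Without arcs a cut can be crossed only inside a block, and no block leaves this
    fibre.\<close>
  define S where "S = {x \<in> V. \<pi> x = \<pi> v}"
  have "S \<subseteq> V" "v \<in> S" "u \<notin> S" using assms ne by (auto simp: S_def)
  then obtain x y where "x \<in> S" "y \<in> V - S" "\<pi> x = \<pi> y"
    using cut_connectedE[OF assms(1), of S] assms(2) by (metis empty_iff)
  then show False by (simp add: S_def)
qed

text \<open>Deletion-contraction removes all arcs. The arcless series is a product of power sums,
  one per block, and the blocks are separated by an inner induction on \<open>V\<close>.\<close>

lemma colouring_series_sym_fun:
  assumes "finite V" "V \<noteq> {}" "E \<subseteq> V \<times> V"
  shows "colouring_series V E \<pi> \<in> sym_fun (card V)"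
  using assms
proof (induction "card E" arbitrary: V E \<pi>)
  case 0
  have "finite E" using 0 by (meson finite_SigmaI finite_subset)
  then have E: "E = {}" using 0 by simp
  show ?case
    using 0(2,3) unfolding E
  proof (induction V rule: finite_psubset_induct)
    case (psubset V)
    show ?case
    proof (cases "cut_connected V {} \<pi>")
      case True
      obtain v where v: "v \<in> V" using psubset by blast
      have "colouring_series V {} \<pi> = power_sum (card V)"
        by (rule colouring_series_single_block[OF \<open>finite V\<close> v])
          (rule cut_connected_no_edges[OF True _ v])
      then show ?thesis using psubset by (simp add: power_sum_sym_fun card_gt_0_iff)
    next
      case False
      then obtain A B where AB: "A \<noteq> {}" "B \<noteq> {}" "A \<subset> V" "B \<subset> V" "card A + card B = card V"
        "colouring_series V {} \<pi> = colouring_series A ({} \<inter> A \<times> A) \<pi> * colouring_series B ({} \<inter> B \<times> B) \<pi>"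
        by (rule not_cut_connected_split[OF \<open>finite V\<close>, rotated]) auto
      then have "colouring_series V {} \<pi> = colouring_series A {} \<pi> * colouring_series B {} \<pi>" by simp
      moreover have "colouring_series A {} \<pi> * colouring_series B {} \<pi> \<in> sym_fun (card A + card B)"
        using psubset.IH AB by (intro sym_fun_times) auto
      ultimately show ?thesis by (simp only: AB(5))
    qed
  qed
next
  case (Suc k)
  have finE: "finite E" using Suc.prems by (meson finite_SigmaI finite_subset)
  have "E \<noteq> {}" using Suc.hyps(2) by auto
  then obtain e where "e \<in> E" by blast
  then obtain u v where e: "(u, v) \<in> E" by (cases e) blast
  have uv: "u \<in> V" "v \<in> V" using e Suc.prems by auto
  have k: "k = card (E - {(u, v)})" using Suc.hyps(2) finE e by simp
  have sub: "E - {(u, v)} \<subseteq> V \<times> V" using Suc.prems by blast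
  show ?case unfolding deletion_contraction[OF Suc.prems(1) e uv]
    by (intro sym_fun_diff Suc.hyps(1)[OF k] Suc.prems sub)
qed

lemma e_coeff_disconnected:
  assumes "finite V" "E \<subseteq> V \<times> V" "\<not> cut_connected V E \<pi>"
  shows "e_coeff {#card V#} (colouring_series V E \<pi>) = 0"
proof -
  obtain A B where AB: "A \<noteq> {}" "B \<noteq> {}" "A \<subset> V" "B \<subset> V" "card A + card B = card V"
    "colouring_series V E \<pi> = colouring_series A (E \<inter> A \<times> A) \<pi> * colouring_series B (E \<inter> B \<times> B) \<pi>"
    using not_cut_connected_split[OF assms] by metis
  have fin: "finite A" "finite B" using AB assms(1) finite_subset by blast+
  have pos: "0 < card A" "0 < card B" using fin AB by (simp_all add: card_gt_0_iff)
  show ?thesis unfolding AB(6)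
    by (rule e_coeff_times[OF colouring_series_sym_fun colouring_series_sym_fun pos])
      (use fin AB pos in auto)
qed

text \<open>The sign makes the deletion-contraction recurrence additive.\<close>

definition signed_top :: "'a set \<Rightarrow> 'a rel \<Rightarrow> ('a \<Rightarrow> 'a) \<Rightarrow> rat" where
  "signed_top V E \<pi> = (-1) ^ (card V + card (\<pi> ` V)) * e_coeff {#card V#} (colouring_series V E \<pi>)"

lemma card_merge_image:
  assumes "finite V" "u \<in> V" "v \<in> V" "\<pi> u \<noteq> \<pi> v"
  shows "card (\<pi> ` V) = Suc (card (merge \<pi> u v ` V))"
proof -
  have "merge \<pi> u v ` V = \<pi> ` V - {\<pi> v}"
    using assms by (auto simp: merge_def image_iff)
  then show ?thesis using assms card.remove[of "\<pi> ` V" "\<pi> v"] by simp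
qed

text \<open>As \<open>u\<close> and \<open>v\<close> lie in different blocks, contraction loses
  exactly one block, and the resulting sign cancels the minus.\<close>

lemma signed_top_deletion_contraction:
  assumes "finite V" "E \<subseteq> V \<times> V" "(u, v) \<in> E" "\<pi> u \<noteq> \<pi> v"
  shows "signed_top V E \<pi> = signed_top V (E - {(u, v)}) \<pi> + signed_top V (E - {(u, v)}) (merge \<pi> u v)"
proof -
  have uv: "u \<in> V" "v \<in> V" using assms by auto
  have *: "colouring_series V (E - {(u, v)}) \<rho> \<in> sym_fun (card V)" for \<rho>
    by (rule colouring_series_sym_fun) (use assms uv in auto)
  show ?thesis
    by (simp add: signed_top_def deletion_contraction[OF assms(1,3) uv, of \<pi>] e_coeff_diff[OF * *]
        card_merge_image[OF assms(1) uv assms(4)] algebra_simps)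
qed

lemma signed_top_disconnected:
  "finite V \<Longrightarrow> E \<subseteq> V \<times> V \<Longrightarrow> \<not> cut_connected V E \<pi> \<Longrightarrow> signed_top V E \<pi> = 0"
  by (simp add: signed_top_def e_coeff_disconnected)

lemma signed_top_loop:
  assumes "E \<subseteq> V \<times> V" "(u, v) \<in> E" "\<pi> u = \<pi> v"
  shows "signed_top V E \<pi> = 0"
proof -
  have "colouring_series V E \<pi> = 0" using assms by (intro colouring_series_loop[OF assms(2) _ _ assms(3)]) blast+
  then show ?thesis by (simp add: signed_top_def)
qed

lemma connected_no_edges:
  assumes "finite V" "V \<noteq> {}" "cut_connected V {} \<pi>"
  shows "card (\<pi> ` V) = 1" and "signed_top V {} \<pi> = of_nat (card V)"
proof -
  obtain v where v: "v \<in> V" using assms by blast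
  have "\<pi> ` V = (\<lambda>_. \<pi> v) ` V"
    by (rule image_cong[OF refl cut_connected_no_edges[OF assms(3) _ v]])
  then have "\<pi> ` V = {\<pi> v}" using v by blast
  then show c: "card (\<pi> ` V) = 1" by simp
  have "colouring_series V {} \<pi> = power_sum (card V)"
    by (rule colouring_series_single_block[OF \<open>finite V\<close> v])
      (rule cut_connected_no_edges[OF assms(3) _ v])
  moreover have pos: "0 < card V" using assms by (simp add: card_gt_0_iff)
  \<comment> \<open>The sign in \<open>signed_top\<close> for a single block is the sign of the top
    coefficient of the power sum; the exponents add up to an even number.\<close>
  moreover have "(-1 :: rat) ^ (card V + 1) * (-1) ^ (card V - 1) = 1"
    using pos by (simp flip: power_add)
  ultimately show "signed_top V {} \<pi> = of_nat (card V)"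
    by (simp add: signed_top_def c e_coeff_power_sum flip: mult.assoc)
qed

text \<open>A cut that keeps \<open>u\<close> and \<open>v\<close> on one side is not crossed by the
  deleted arc, so only separating cuts have to be checked.\<close>

lemma cut_connected_delete:
  assumes "cut_connected V E \<pi>"
    and "\<And>A. A \<subseteq> V \<Longrightarrow> (u \<in> A) \<noteq> (v \<in> A) \<Longrightarrow>
      (\<exists>x\<in>A. \<exists>y\<in>V - A. (x, y) \<in> E - {(u, v)} \<or> (y, x) \<in> E - {(u, v)} \<or> \<pi> x = \<pi> y)"
  shows "cut_connected V (E - {(u, v)}) \<pi>"
  unfolding cut_connected_def
proof (intro allI impI)
  fix A assume A: "A \<subseteq> V" "A \<noteq> {}" "A \<noteq> V"
  show "\<exists>x\<in>A. \<exists>y\<in>V - A. (x, y) \<in> E - {(u, v)} \<or> (y, x) \<in> E - {(u, v)} \<or> \<pi> x = \<pi> y"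
  proof (cases "(u \<in> A) = (v \<in> A)")
    case False
    then show ?thesis using assms(2) A by blast
  next
    case True
    obtain x y where "x \<in> A" "y \<in> V - A" "(x, y) \<in> E \<or> (y, x) \<in> E \<or> \<pi> x = \<pi> y"
      using cut_connectedE[OF assms(1) A] by metis
    then show ?thesis using True by blast
  qed
qed

lemma cut_connected_delete_loop:
  assumes "cut_connected V E \<pi>" "u \<in> V" "v \<in> V" "\<pi> u = \<pi> v"
  shows "cut_connected V (E - {(u, v)}) \<pi>"
proof (rule cut_connected_delete[OF assms(1)])
  fix A assume "(u \<in> A) \<noteq> (v \<in> A)"
  then have "u \<in> A \<and> v \<in> V - A \<or> v \<in> A \<and> u \<in> V - A" using assms(2,3) by blast
  then show "\<exists>x\<in>A. \<exists>y\<in>V - A. (x, y) \<in> E - {(u, v)} \<or> (y, x) \<in> E - {(u, v)} \<or> \<pi> x = \<pi> y"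
    using assms(4) by metis
qed

text \<open>An arc turned into a loop by the contraction joins the blocks of \<open>u\<close> and
  \<open>v\<close>. A cut between \<open>u\<close> and \<open>v\<close> is therefore crossed by this
  arc or cuts through one of the two blocks. The reverse of \<open>(u, v)\<close> is such an arc, so
  with the symmetric arc set of a graph this case arises at the first deletion.\<close>

lemma cut_connected_delete_parallel:
  assumes "cut_connected V E \<pi>" "E \<subseteq> V \<times> V" "(u, v) \<in> E" "(x, y) \<in> E - {(u, v)}"
    and "merge \<pi> u v x = merge \<pi> u v y" "\<pi> x \<noteq> \<pi> y"
  shows "cut_connected V (E - {(u, v)}) \<pi>"
proof (rule cut_connected_delete[OF assms(1)])
  fix A assume A: "A \<subseteq> V" "(u \<in> A) \<noteq> (v \<in> A)"
  have V: "u \<in> V" "v \<in> V" "x \<in> V" "y \<in> V" using assms by auto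
  have "\<pi> x = \<pi> u \<and> \<pi> y = \<pi> v \<or> \<pi> x = \<pi> v \<and> \<pi> y = \<pi> u"
    using assms(5,6) unfolding merge_eq_iff by blast
  moreover have "p \<in> A \<and> q \<in> V - A \<or> q \<in> A \<and> p \<in> V - A" if "p \<in> V" "q \<in> V" "(p \<in> A) \<noteq> (q \<in> A)" for p q
    using that by blast
  ultimately show "\<exists>x\<in>A. \<exists>y\<in>V - A. (x, y) \<in> E - {(u, v)} \<or> (y, x) \<in> E - {(u, v)} \<or> \<pi> x = \<pi> y"
    using A V assms(4) by metis
qed

text \<open>Where the deleted arc was the one crossing a cut, the merged block crosses it
  instead.\<close>

lemma cut_connected_contract:
  assumes "cut_connected V E \<pi>"
  shows "cut_connected V (E - {(u, v)}) (merge \<pi> u v)"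
  unfolding cut_connected_def
proof (intro allI impI)
  fix A assume A: "A \<subseteq> V" "A \<noteq> {}" "A \<noteq> V"
  obtain x y where xy: "x \<in> A" "y \<in> V - A" "(x, y) \<in> E \<or> (y, x) \<in> E \<or> \<pi> x = \<pi> y"
    using cut_connectedE[OF assms(1) A] by metis
  then have "(x, y) \<in> E - {(u, v)} \<or> (y, x) \<in> E - {(u, v)} \<or> merge \<pi> u v x = merge \<pi> u v y"
    unfolding merge_eq_iff by blast
  with xy show "\<exists>x\<in>A. \<exists>y\<in>V - A. (x, y) \<in> E - {(u, v)} \<or> (y, x) \<in> E - {(u, v)} \<or> merge \<pi> u v x = merge \<pi> u v y"
    by blast
qed

text \<open>Both claims go through one induction: of the two summands in the recurrence, one
  supplies the bound and the other has to be nonnegative, even when it is disconnected or has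
  loops.\<close>

lemma signed_top_bounds:
  assumes "finite V" "V \<noteq> {}" "E \<subseteq> V \<times> V"
  shows "0 \<le> signed_top V E \<pi> \<and>
    (cut_connected V E \<pi> \<and> (\<forall>u v. (u, v) \<in> E \<longrightarrow> \<pi> u \<noteq> \<pi> v) \<longrightarrow> of_nat (card V) \<le> signed_top V E \<pi>)"
  using assms(3)
proof (induction "card E" arbitrary: E \<pi>)
  case 0
  have "finite E" using 0 assms by (meson finite_SigmaI finite_subset)
  then have E: "E = {}" using 0 by simp
  show ?case
    using signed_top_disconnected[OF assms(1), of "{}" \<pi>] connected_no_edges(2)[OF assms(1,2), of \<pi>]
    unfolding E by (cases "cut_connected V {} \<pi>") auto
next
  case (Suc k)
  show ?case
  proof (cases "cut_connected V E \<pi> \<and> (\<forall>u v. (u, v) \<in> E \<longrightarrow> \<pi> u \<noteq> \<pi> v)")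
    case False
    then have "signed_top V E \<pi> = 0"
      using signed_top_disconnected[OF assms(1) Suc.prems] signed_top_loop[OF Suc.prems] by blast
    then show ?thesis using False by (intro conjI impI) (simp, blast)
  next
    case True
    have finE: "finite E" using assms Suc.prems by (meson finite_SigmaI finite_subset)
    have "E \<noteq> {}" using Suc.hyps(2) by auto
    then obtain e where "e \<in> E" by blast
  then obtain u v where e: "(u, v) \<in> E" by (cases e) blast
    define E' where "E' = E - {(u, v)}"
    have k: "k = card E'" using Suc.hyps(2) finE e by (simp add: E'_def)
    have sub: "E' \<subseteq> V \<times> V" using Suc.prems by (auto simp: E'_def)
    have dc: "signed_top V E \<pi> = signed_top V E' \<pi> + signed_top V E' (merge \<pi> u v)"
      unfolding E'_def using True e by (intro signed_top_deletion_contraction[OF assms(1) Suc.prems]) auto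
    have IH: "0 \<le> signed_top V E' \<rho>"
      "cut_connected V E' \<rho> \<Longrightarrow> (\<And>u v. (u, v) \<in> E' \<Longrightarrow> \<rho> u \<noteq> \<rho> v) \<Longrightarrow> of_nat (card V) \<le> signed_top V E' \<rho>"
      for \<rho> using Suc.hyps(1)[OF k sub, of \<rho>] by auto
    have "of_nat (card V) \<le> signed_top V E \<pi>"
      \<comment> \<open>If some edge is parallel to (u, v), the contraction has a loop, and it is the deletion that
        stays connected; otherwise the contraction alone reaches the bound.\<close>
    proof (cases "\<exists>x y. (x, y) \<in> E' \<and> merge \<pi> u v x = merge \<pi> u v y")
      case par: True
      then obtain x y where xy: "(x, y) \<in> E'" "merge \<pi> u v x = merge \<pi> u v y" by blast
      have "cut_connected V E' \<pi>"
        using cut_connected_delete_parallel[OF _ Suc.prems e, of \<pi> x y] xy True by (simp add: E'_def)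
      then have "of_nat (card V) \<le> signed_top V E' \<pi>"
        using True by (intro IH(2)) (auto simp: E'_def)
      then show ?thesis using dc IH(1)[of "merge \<pi> u v"] by simp
    next
      case False
      have "cut_connected V E' (merge \<pi> u v)"
        unfolding E'_def using True by (intro cut_connected_contract) blast
      then have "of_nat (card V) \<le> signed_top V E' (merge \<pi> u v)"
        using False by (intro IH(2)) auto
      then show ?thesis using dc IH(1)[of \<pi>] by simp
    qed
    moreover have "(0::rat) \<le> of_nat (card V)" by simp
    ultimately show ?thesis by linarith
  qed
qed

text \<open>The count of edges in a connected graph, with blocks as vertices: contracting an arc
  removes one arc and at most one block.\<close>

lemma cut_connected_card:
  assumes "finite V" "V \<noteq> {}" "E \<subseteq> V \<times> V" "cut_connected V E \<pi>"
  shows "card (\<pi> ` V) \<le> Suc (card E)"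
  using assms(3,4)
proof (induction "card E" arbitrary: E \<pi>)
  case 0
  have "finite E" using 0 assms by (meson finite_SigmaI finite_subset)
  then have E: "E = {}" using 0 by simp
  show ?case using connected_no_edges(1)[OF assms(1,2)] 0 unfolding E by simp
next
  case (Suc k)
  have finE: "finite E" using assms Suc.prems by (meson finite_SigmaI finite_subset)
  have "E \<noteq> {}" using Suc.hyps(2) by auto
  then obtain e where "e \<in> E" by blast
  then obtain u v where e: "(u, v) \<in> E" by (cases e) blast
  have uv: "u \<in> V" "v \<in> V" using e Suc.prems by auto
  have k: "k = card (E - {(u, v)})" using Suc.hyps(2) finE e by simp
  have sub: "E - {(u, v)} \<subseteq> V \<times> V" using Suc.prems by blast
  show ?case
  proof (cases "\<pi> u = \<pi> v")
    case True
    have "card (\<pi> ` V) \<le> Suc k"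
      using Suc.hyps(1)[OF k sub cut_connected_delete_loop[OF Suc.prems(2) uv True]] k by simp
    then show ?thesis using Suc.hyps(2) by simp
  next
    case False
    have "card (merge \<pi> u v ` V) \<le> Suc k"
      using Suc.hyps(1)[OF k sub cut_connected_contract[OF Suc.prems(2)]] k by simp
    then show ?thesis using Suc.hyps(2) card_merge_image[where \<pi> = \<pi>, OF assms(1) uv False] by simp
  qed
qed

text \<open>Together with connectedness the inequality says that \<open>E\<close> is a tree on the
  blocks. Every arc is a bridge, so deletion contributes 0 and contraction is again a tree, down to
  a single block of value \<open>card V\<close>.\<close>

lemma signed_top_tree:
  assumes "finite V" "V \<noteq> {}" "E \<subseteq> V \<times> V" "cut_connected V E \<pi>" "card E < card (\<pi> ` V)"
  shows "signed_top V E \<pi> = of_nat (card V)"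
  using assms(3-5)
proof (induction "card E" arbitrary: E \<pi>)
  case 0
  have "finite E" using 0 assms by (meson finite_SigmaI finite_subset)
  then have E: "E = {}" using 0 by simp
  show ?case using connected_no_edges(2)[OF assms(1,2)] 0 unfolding E by simp
next
  case (Suc k)
  have finE: "finite E" using assms Suc.prems by (meson finite_SigmaI finite_subset)
  have "E \<noteq> {}" using Suc.hyps(2) by auto
  then obtain e where "e \<in> E" by blast
  then obtain u v where e: "(u, v) \<in> E" by (cases e) blast
  have uv: "u \<in> V" "v \<in> V" using e Suc.prems by auto
  have k: "k = card (E - {(u, v)})" using Suc.hyps(2) finE e by simp
  have sub: "E - {(u, v)} \<subseteq> V \<times> V" using Suc.prems by blast
  \<comment> \<open>One arc fewer cannot connect this many blocks.\<close>
  have nc: "\<not> cut_connected V (E - {(u, v)}) \<pi>"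
    using cut_connected_card[OF assms(1,2) sub, of \<pi>] Suc.prems(3) Suc.hyps(2) k by linarith
  \<comment> \<open>A loop could be deleted without losing connectedness.\<close>
  have ne: "\<pi> u \<noteq> \<pi> v"
    using nc cut_connected_delete_loop[OF Suc.prems(2) uv] by blast
  have "card (E - {(u, v)}) < card (merge \<pi> u v ` V)"
    using Suc.prems(3) Suc.hyps(2) k card_merge_image[where \<pi> = \<pi>, OF assms(1) uv ne] by simp
  then have "signed_top V (E - {(u, v)}) (merge \<pi> u v) = of_nat (card V)"
    by (rule Suc.hyps(1)[OF k sub cut_connected_contract[OF Suc.prems(2)]])
  then show ?case
    using signed_top_deletion_contraction[OF assms(1) Suc.prems(1) e ne]
      signed_top_disconnected[OF assms(1) sub nc] by simp
qed

section \<open>The poset\<close>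

lemma mcoeff_elem_sym_nonneg: "0 \<le> mcoeff (elem_sym k) m"
  by simp

lemma mcoeff_times_nonneg:
  "(\<And>m. 0 \<le> mcoeff F m) \<Longrightarrow> (\<And>m. 0 \<le> mcoeff G m) \<Longrightarrow> 0 \<le> mcoeff (F * G) m"
  unfolding mcoeff_times by (intro sum_nonneg) (auto intro!: mult_nonneg_nonneg)

lemma mcoeff_e_part_nonneg: "0 \<le> mcoeff (e_part \<mu>) m"
  by (induction \<mu> arbitrary: m)
    (simp, simp only: e_part_add, rule mcoeff_times_nonneg[OF mcoeff_elem_sym_nonneg])

text \<open>Distributing the elements of \<open>T\<close> over the parts of \<mu> in one way gives a
  positive contribution, and all others are nonnegative.\<close>

lemma mcoeff_e_part_squarefree_pos:
  assumes "finite T" "card T = \<Sum>\<^sub># \<mu>"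
  shows "0 < mcoeff (e_part \<mu>) (mset_set T)"
  using assms
proof (induction \<mu> arbitrary: T)
  case empty
  then show ?case by simp
next
  case (add k \<mu>)
  obtain A where A: "A \<subseteq> T" "card A = k"
    using add.prems obtain_subset_with_card_n[of k T] by auto
  have fin: "finite A" "finite (T - A)" using A add.prems finite_subset by auto
  have "mset_set A + mset_set (T - A) = mset_set (A \<union> (T - A))"
    using fin by (intro mset_set_Union[symmetric]) auto
  also have "A \<union> (T - A) = T" using A by blast
  finally have split: "mset_set A + mset_set (T - A) = mset_set T" .
  have "card (T - A) = \<Sum>\<^sub># \<mu>" using A add.prems fin by (simp add: card_Diff_subset)
  then have "0 < mcoeff (e_part \<mu>) (mset_set (T - A))" using add.IH fin by blast
  moreover have "mcoeff (elem_sym k) (mset_set A) = 1" using A by (simp add: count_mset_set')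
  ultimately have "0 < mcoeff (elem_sym k) (mset_set A) * mcoeff (e_part \<mu>) (mset_set (T - A))" by simp
  then have "0 < (\<Sum>(a, b) | a + b = mset_set T. mcoeff (elem_sym k) a * mcoeff (e_part \<mu>) b)"
    using split
    by (intro sum_pos2[OF finite_msplit, of "(mset_set A, mset_set (T - A))"])
      (auto intro!: mult_nonneg_nonneg mcoeff_e_part_nonneg simp del: mcoeff_simps(7) simp: mcoeff_elem_sym_nonneg)
  then show ?case by (simp only: e_part_add mcoeff_times)
qed

text \<open>A linear functional that is positive on each basis element of degree \<open>n\<close>
  can vanish on an e-positive function only if all coordinates vanish.\<close>

lemma e_positive_squarefree:
  assumes "F \<in> sym_fun n" "e_positive F"
  shows "0 \<le> mcoeff F (mset_set {..<n})"
    and "mcoeff F (mset_set {..<n}) = 0 \<Longrightarrow> F = 0"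
proof -
  let ?m = "mset_set {..<n}"
  obtain S where S: "finite S" "S \<subseteq> partitions_of n"
    "F = (\<Sum>\<mu>\<in>S. mps_scale (e_coeff \<mu> F) (e_part \<mu>))"
    using sym_fun_expansion[OF assms(1)] by blast
  have F: "mcoeff F ?m = (\<Sum>\<mu>\<in>S. e_coeff \<mu> F * mcoeff (e_part \<mu>) ?m)"
    by (subst S(3)) (simp add: mcoeff_sum)
  have c: "0 \<le> e_coeff \<mu> F" and p: "0 < mcoeff (e_part \<mu>) ?m" if "\<mu> \<in> S" for \<mu>
    using that S(2) assms(2) mcoeff_e_part_squarefree_pos[of "{..<n}" \<mu>]
    by (auto simp: partitions_of_def e_positive_def)
  have nn: "0 \<le> e_coeff \<mu> F * mcoeff (e_part \<mu>) ?m" if "\<mu> \<in> S" for \<mu>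
    using c[OF that] p[OF that] by simp
  show "0 \<le> mcoeff F ?m"
    unfolding F by (rule sum_nonneg[OF nn])
  assume "mcoeff F ?m = 0"
  then have "\<forall>\<mu>\<in>S. e_coeff \<mu> F * mcoeff (e_part \<mu>) ?m = 0"
    unfolding F by (subst (asm) sum_nonneg_eq_0_iff[OF S(1) nn])
  then have "e_coeff \<mu> F = 0" if "\<mu> \<in> S" for \<mu> using p that by fastforce
  then show "F = 0" by (subst S(3)) simp
qed

text \<open>Precomposition with a bijection of the domains, restricted so as to stay extensional. It
  makes squarefree coefficients comparable between graphs on different vertex sets.\<close>

lemma card_bijections_eq:
  fixes A :: "'a set" and B :: "'b set" and S :: "'c set"
  assumes "finite A" "finite B" "finite S" "card A = card S" "card B = card S"
  shows "card {f \<in> A \<rightarrow>\<^sub>E UNIV. bij_betw f A S} = card {f \<in> B \<rightarrow>\<^sub>E UNIV. bij_betw f B S}"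
proof -
  obtain b where b: "bij_betw b B A" using assms finite_same_card_bij[of B A] by auto
  let ?c = "the_inv_into B b"
  have c: "bij_betw ?c A B" using b by (rule bij_betw_the_inv_into)
  have bc: "\<And>x. x \<in> A \<Longrightarrow> b (?c x) = x" "\<And>x. x \<in> B \<Longrightarrow> ?c (b x) = x"
    using b by (auto simp: bij_betw_def f_the_inv_into_f the_inv_into_f_f)
  have mem: "b x \<in> A" if "x \<in> B" for x using b that by (auto simp: bij_betw_def)
  have mem': "?c x \<in> B" if "x \<in> A" for x using c that by (auto simp: bij_betw_def)
  have "bij_betw (\<lambda>f. restrict (f \<circ> b) B) {f \<in> A \<rightarrow>\<^sub>E UNIV. bij_betw f A S} {f \<in> B \<rightarrow>\<^sub>E UNIV. bij_betw f B S}"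
  proof (rule bij_betw_byWitness[where f' = "\<lambda>f. restrict (f \<circ> ?c) A"])
    show "\<forall>f\<in>{f \<in> A \<rightarrow>\<^sub>E UNIV. bij_betw f A S}. restrict (restrict (f \<circ> b) B \<circ> ?c) A = f"
      using bc mem' by (auto simp: fun_eq_iff PiE_def extensional_def)
    show "\<forall>f\<in>{f \<in> B \<rightarrow>\<^sub>E UNIV. bij_betw f B S}. restrict (restrict (f \<circ> ?c) A \<circ> b) B = f"
      using bc mem by (auto simp: fun_eq_iff PiE_def extensional_def)
    show "(\<lambda>f. restrict (f \<circ> b) B) ` {f \<in> A \<rightarrow>\<^sub>E UNIV. bij_betw f A S} \<subseteq> {f \<in> B \<rightarrow>\<^sub>E UNIV. bij_betw f B S}"
      using bij_betw_trans[OF b] by (auto simp: bij_betw_restrict_eq simp del: o_apply)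
    show "(\<lambda>f. restrict (f \<circ> ?c) A) ` {f \<in> B \<rightarrow>\<^sub>E UNIV. bij_betw f B S} \<subseteq> {f \<in> A \<rightarrow>\<^sub>E UNIV. bij_betw f A S}"
      using bij_betw_trans[OF c] by (auto simp: bij_betw_restrict_eq simp del: o_apply)
  qed
  then show ?thesis by (rule bij_betw_same_card)
qed

lemma connected_graphsD:
  assumes "G \<in> connected_graphs n"
  shows "finite (pverts G)" "card (pverts G) = n" "parcs G \<subseteq> pverts G \<times> pverts G" "pverts G \<noteq> {}"
    and "(u, v) \<in> parcs G \<Longrightarrow> u \<noteq> v" and "cut_connected (pverts G) (parcs G) (\<lambda>x. x)"
proof -
  interpret pair_graph G using assms by (simp add: connected_graphs_def)
  show "finite (pverts G)" by (rule pair_finite_verts)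
  show "card (pverts G) = n" using assms by (simp add: connected_graphs_def)
  show "parcs G \<subseteq> pverts G \<times> pverts G" using wellformed' by auto
  show "(u, v) \<in> parcs G \<Longrightarrow> u \<noteq> v" by (rule no_loops')
  have conn: "pverts G \<noteq> {}" "\<And>u v. u \<in> pverts G \<Longrightarrow> v \<in> pverts G \<Longrightarrow> (u, v) \<in> rtrancl_on (pverts G) (symcl (parcs G))"
    using assms by (auto simp: connected_graphs_def connected_conv)
  then show "pverts G \<noteq> {}" by simp
  show "cut_connected (pverts G) (parcs G) (\<lambda>x. x)"
    unfolding cut_connected_def
  proof (intro allI impI, rule ccontr)
    fix A assume A: "A \<subseteq> pverts G" "A \<noteq> {}" "A \<noteq> pverts G"
      and no: "\<not> (\<exists>u\<in>A. \<exists>v\<in>pverts G - A. (u, v) \<in> parcs G \<or> (v, u) \<in> parcs G \<or> u = v)"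
    obtain u v where uv: "u \<in> A" "v \<in> pverts G - A" using A by blast
    \<comment> \<open>A walk starting in \<open>A\<close> cannot leave it if no arc crosses the
      cut.\<close>
    have "(u, v) \<in> rtrancl_on (pverts G) (symcl (parcs G))" using conn uv A by blast
    then have "v \<in> A"
    proof (induction rule: rtrancl_on_induct)
      case (step y z)
      then have "(y, z) \<in> parcs G \<or> (z, y) \<in> parcs G" by (auto simp: symcl_def)
      then show ?case using step no by blast
    qed (rule uv)
    then show False using uv by simp
  qed
qed

text \<open>The contributing maps are the bijections onto the n colours, and a bijection is
  automatically proper in a graph without loops. The count is thus independent of the edges.\<close>

lemma squarefree_chromatic_sym:
  assumes "G \<in> connected_graphs n"
  shows "mcoeff (chromatic_sym G) (mset_set {..<n}) =
    of_nat (card {f \<in> {..<n} \<rightarrow>\<^sub>E UNIV. bij_betw f {..<n} {..<n}})"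
proof -
  note G = connected_graphsD[OF assms]
  have "image_mset \<kappa> (mset_set (pverts G)) = mset_set {..<n} \<longleftrightarrow> bij_betw \<kappa> (pverts G) {..<n}" for \<kappa>
  proof
    assume eq: "image_mset \<kappa> (mset_set (pverts G)) = mset_set {..<n}"
    have im: "\<kappa> ` pverts G = {..<n}" using arg_cong[OF eq, of set_mset] G(1) by simp
    moreover have "inj_on \<kappa> (pverts G)" by (rule eq_card_imp_inj_on[OF G(1)]) (simp add: im G(2))
    ultimately show "bij_betw \<kappa> (pverts G) {..<n}" by (simp add: bij_betw_def)
  qed (simp add: bij_betw_def image_mset_mset_set)
  moreover have "\<kappa> \<in> proper_colourings G" if "\<kappa> \<in> pverts G \<rightarrow>\<^sub>E UNIV" "bij_betw \<kappa> (pverts G) {..<n}" for \<kappa>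
  proof -
    have "\<kappa> u \<noteq> \<kappa> v" if "(u, v) \<in> parcs G" for u v
      using that \<open>bij_betw \<kappa> _ _\<close> G(3) G(5) by (auto simp: bij_betw_def dest: inj_onD)
    then show ?thesis using that by (auto simp: proper_colourings_def)
  qed
  moreover have "\<kappa> \<in> pverts G \<rightarrow>\<^sub>E UNIV" if "\<kappa> \<in> proper_colourings G" for \<kappa>
    using that by (simp add: proper_colourings_def)
  ultimately have "{\<kappa> \<in> proper_colourings G. image_mset \<kappa> (mset_set (pverts G)) = mset_set {..<n}} =
      {f \<in> pverts G \<rightarrow>\<^sub>E UNIV. bij_betw f (pverts G) {..<n}}"
    by blast
  moreover have "card {f \<in> pverts G \<rightarrow>\<^sub>E UNIV. bij_betw f (pverts G) {..<n}} =
      card {f \<in> {..<n} \<rightarrow>\<^sub>E UNIV. bij_betw f {..<n} {..<n}}"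
    by (rule card_bijections_eq) (simp_all add: G)
  ultimately show ?thesis by (simp add: chromatic_sym.rep_eq)
qed

lemma squarefree_chromatic_sym_pos:
  assumes "G \<in> connected_graphs n"
  shows "0 < mcoeff (chromatic_sym G) (mset_set {..<n})"
proof -
  have "{f \<in> {..<n} \<rightarrow>\<^sub>E UNIV. bij_betw f {..<n} {..<n}} \<subseteq> {..<n} \<rightarrow>\<^sub>E {..<n}"
    by (auto simp: PiE_def bij_betw_def Pi_iff)
  then have "finite {f \<in> {..<n} \<rightarrow>\<^sub>E UNIV. bij_betw f {..<n} {..<n}}"
    by (rule finite_subset) (simp add: finite_PiE)
  moreover have "(\<lambda>x\<in>{..<n}. x) \<in> {f \<in> {..<n} \<rightarrow>\<^sub>E UNIV. bij_betw f {..<n} {..<n}}"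
    by (auto simp: bij_betw_def inj_on_def)
  ultimately show ?thesis unfolding squarefree_chromatic_sym[OF assms]
    using card_gt_0_iff by (metis (no_types, lifting) empty_iff of_nat_0_less_iff)
qed

section \<open>Comparing graphs by their top coefficient\<close>

definition top_coeff :: "'a pair_pre_digraph \<Rightarrow> rat" where
  "top_coeff G = e_coeff {#card (pverts G)#} (chromatic_sym G)"

lemma chromatic_sym_sym_fun: "G \<in> connected_graphs n \<Longrightarrow> chromatic_sym G \<in> sym_fun n"
  using colouring_series_sym_fun[OF connected_graphsD(1,4,3)] connected_graphsD(2)
  unfolding chromatic_sym_eq by fastforce

text \<open>Before any contraction there are as many blocks as vertices, so the sign is +1.\<close>

lemma top_coeff_eq: "G \<in> connected_graphs n \<Longrightarrow> top_coeff G = signed_top (pverts G) (parcs G) (\<lambda>x. x)"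
  by (simp add: top_coeff_def signed_top_def chromatic_sym_eq)

lemma top_coeff_ge:
  assumes "G \<in> connected_graphs n"
  shows "of_nat n \<le> top_coeff G"
  using signed_top_bounds[OF connected_graphsD(1,4,3)[OF assms], of "\<lambda>x. x"] connected_graphsD(2,5,6)[OF assms]
  by (auto simp: top_coeff_eq[OF assms])

lemma top_coeff_pos: "G \<in> connected_graphs n \<Longrightarrow> 0 < top_coeff G"
  using top_coeff_ge connected_graphsD(1,2,4) by (metis card_gt_0_iff of_nat_0_less_iff order_less_le_trans)

lemma X_e_eq: "X_e G H = chromatic_sym G - mps_scale (top_coeff G / top_coeff H) (chromatic_sym H)"
  by (simp add: X_e_def top_coeff_def)

lemma X_e_sym_fun: "G \<in> connected_graphs n \<Longrightarrow> H \<in> connected_graphs n \<Longrightarrow> X_e G H \<in> sym_fun n"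
  unfolding X_e_eq by (intro sym_fun_diff sym_fun_scale chromatic_sym_sym_fun)

lemma e_positive_X_e:
  assumes "G \<in> connected_graphs n" "H \<in> connected_graphs n" "e_positive (X_e G H)"
  shows "top_coeff G \<le> top_coeff H" and "top_coeff G = top_coeff H \<Longrightarrow> chromatic_sym G = chromatic_sym H"
proof -
  let ?m = "mset_set {..<n}"
  define c where "c = mcoeff (chromatic_sym G) ?m"
  have c: "0 < c" "mcoeff (chromatic_sym H) ?m = c"
    using squarefree_chromatic_sym_pos[OF assms(1)] by (auto simp: c_def squarefree_chromatic_sym assms)
  have eq: "mcoeff (X_e G H) ?m = c * (1 - top_coeff G / top_coeff H)"
    by (simp add: X_e_eq c c_def[symmetric] algebra_simps)
  have pos: "0 < top_coeff H" using top_coeff_pos assms by blast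
  have "0 \<le> c * (1 - top_coeff G / top_coeff H)"
    using e_positive_squarefree(1)[OF X_e_sym_fun[OF assms(1,2)] assms(3)] by (simp only: eq)
  then show "top_coeff G \<le> top_coeff H" using c pos by (simp add: zero_le_mult_iff)
  assume t: "top_coeff G = top_coeff H"
  then have "mcoeff (X_e G H) ?m = 0" using pos by (simp add: eq)
  then have "X_e G H = 0"
    using e_positive_squarefree(2)[OF X_e_sym_fun[OF assms(1,2)] assms(3)] by blast
  then show "chromatic_sym G = chromatic_sym H" using t pos by (simp add: X_e_eq)
qed

lemma e_positive_add: "F \<in> sym_fun n \<Longrightarrow> G \<in> sym_fun n \<Longrightarrow> e_positive F \<Longrightarrow> e_positive G \<Longrightarrow> e_positive (F + G)"
  by (auto simp: e_positive_def e_coeff_add)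

lemma e_positive_scale: "F \<in> sym_fun n \<Longrightarrow> e_positive F \<Longrightarrow> 0 \<le> c \<Longrightarrow> e_positive (mps_scale c F)"
  by (auto simp: e_positive_def e_coeff_scale)

lemma X_e_refl: "G \<in> connected_graphs n \<Longrightarrow> e_positive (X_e G G)"
  using top_coeff_pos[of G n] by (simp add: X_e_eq e_positive_def)

lemma X_e_trans:
  assumes "G \<in> connected_graphs n" "H \<in> connected_graphs n" "K \<in> connected_graphs n"
    and "e_positive (X_e G H)" "e_positive (X_e H K)"
  shows "e_positive (X_e G K)"
proof -
  have pos: "0 < top_coeff G" "0 < top_coeff H" using assms top_coeff_pos by blast+
  \<comment> \<open>The ratios of top coefficients multiply, so the two multiples of the chromatic
    function of \<open>H\<close> cancel.\<close>
  have "X_e G K = X_e G H + mps_scale (top_coeff G / top_coeff H) (X_e H K)"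
    using pos by (intro mps_eqI) (simp add: X_e_eq right_diff_distrib)
  also have "e_positive \<dots>"
    using assms pos by (intro e_positive_add[of _ n] e_positive_scale[of _ n] X_e_sym_fun sym_fun_scale) auto
  finally show ?thesis .
qed

lemma X_e_cong:
  assumes "chromatic_sym G = chromatic_sym G'" "chromatic_sym H = chromatic_sym H'"
    and "card (pverts G) = card (pverts G')" "card (pverts H) = card (pverts H')"
  shows "X_e G H = X_e G' H'"
  by (simp add: X_e_def assms)

section \<open>The order on equivalence classes\<close>

lemma equiv_chromatic_equiv: "equiv (connected_graphs n) (chromatic_equiv n)"
  by (rule equivI) (auto simp: chromatic_equiv_def refl_on_def sym_def trans_def)

lemma chromatic_class:
  assumes "C \<in> connected_graphs n // chromatic_equiv n"
  obtains G where "G \<in> connected_graphs n" "C = chromatic_equiv n `` {G}"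
  using assms by (auto elim!: quotientE)

lemma e_poset_le_iff:
  assumes "G \<in> connected_graphs n" "H \<in> connected_graphs n"
  shows "le (e_poset n) (chromatic_equiv n `` {H}) (chromatic_equiv n `` {G}) \<longleftrightarrow> e_positive (X_e G H)"
proof -
  have cong: "X_e G' H' = X_e G H" if "(G, G') \<in> chromatic_equiv n" "(H, H') \<in> chromatic_equiv n" for G' H'
    using that connected_graphsD(2) by (intro X_e_cong) (auto simp: chromatic_equiv_def)
  have self: "(G, G) \<in> chromatic_equiv n" "(H, H) \<in> chromatic_equiv n"
    using assms by (auto simp: chromatic_equiv_def)
  have "le (e_poset n) (chromatic_equiv n `` {H}) (chromatic_equiv n `` {G}) \<longleftrightarrow>
      (\<exists>H' G'. (H, H') \<in> chromatic_equiv n \<and> (G, G') \<in> chromatic_equiv n \<and> e_positive (X_e G' H'))"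
    unfolding e_poset_def by auto
  also have "\<dots> \<longleftrightarrow> e_positive (X_e G H)"
    using cong self by metis
  finally show ?thesis .
qed

lemma partial_order_e_poset: "partial_order (e_poset n)"
proof -
  let ?L = "e_poset n"
  have car: "carrier ?L = connected_graphs n // chromatic_equiv n" and eq: "eq ?L = (=)"
    by (simp_all add: e_poset_def)
  note cls = chromatic_class
  have refl: "le ?L C C" if "C \<in> carrier ?L" for C
    using that unfolding car by (metis cls e_poset_le_iff X_e_refl)
  have antisym: "C = D" if le: "le ?L C D" "le ?L D C" and C: "C \<in> carrier ?L" and D: "D \<in> carrier ?L" for C D
  proof -
    obtain H where H: "H \<in> connected_graphs n" "C = chromatic_equiv n `` {H}" using cls[OF C[unfolded car]] by metis
    obtain G where G: "G \<in> connected_graphs n" "D = chromatic_equiv n `` {G}" using cls[OF D[unfolded car]] by metis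
    have "e_positive (X_e G H)" "e_positive (X_e H G)" using le G H e_poset_le_iff by simp_all
    \<comment> \<open>Each top coefficient bounds the other, so the equality case applies.\<close>
    then have "chromatic_sym G = chromatic_sym H"
      using e_positive_X_e[OF G(1) H(1)] e_positive_X_e(1)[OF H(1) G(1)] by (meson order_antisym)
    then have "(H, G) \<in> chromatic_equiv n" using G H by (simp add: chromatic_equiv_def)
    then show ?thesis using G H equiv_class_eq[OF equiv_chromatic_equiv] by blast
  qed
  have trans: "le ?L C E" if le: "le ?L C D" "le ?L D E" and C: "C \<in> carrier ?L" and D: "D \<in> carrier ?L" and E: "E \<in> carrier ?L" for C D E
  proof -
    obtain K where K: "K \<in> connected_graphs n" "C = chromatic_equiv n `` {K}" using cls[OF C[unfolded car]] by metis
    obtain H where H: "H \<in> connected_graphs n" "D = chromatic_equiv n `` {H}" using cls[OF D[unfolded car]] by metis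
    obtain G where G: "G \<in> connected_graphs n" "E = chromatic_equiv n `` {G}" using cls[OF E[unfolded car]] by metis
    show ?thesis using X_e_trans[OF G(1) H(1) K(1)] le G H K e_poset_le_iff by simp
  qed
  show ?thesis
    by unfold_locales (use refl antisym trans in \<open>auto simp: eq\<close>)
qed

section \<open>Trees as elements of the poset; star and path\<close>

lemma cut_connected_connected:
  assumes "cut_connected V E (\<lambda>x. x)" "V \<noteq> {}"
  shows "Digraph_Component.connected (with_proj \<lparr>pverts = V, parcs = E \<union> E\<inverse>\<rparr>)"
proof -
  let ?R = "rtrancl_on V (symcl (E \<union> E\<inverse>))"
  have "(u, v) \<in> ?R" if u: "u \<in> V" and v: "v \<in> V" for u v
  proof -
    \<comment> \<open>If the reachable set were proper, an arc would cross it and reach a further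
      vertex.\<close>
    define A where "A = {x \<in> V. (u, x) \<in> ?R}"
    have "A = V"
    proof (rule ccontr)
      assume "A \<noteq> V"
      moreover have "A \<subseteq> V" "A \<noteq> {}" using u by (auto simp: A_def)
      ultimately obtain x y where xy: "x \<in> A" "y \<in> V - A" "(x, y) \<in> E \<or> (y, x) \<in> E \<or> x = y"
        using cut_connectedE[OF assms(1)] by metis
      then have "(x, y) \<in> symcl (E \<union> E\<inverse>)" by (auto simp: symcl_def)
      then have "y \<in> A" using xy by (auto simp: A_def intro: rtrancl_on_into_rtrancl_on)
      then show False using xy by simp
    qed
    then show ?thesis using v by (auto simp: A_def)
  qed
  then show ?thesis using assms(2) by (simp add: connected_conv)
qed

lemma tree_in_connected_graphs:
  fixes E :: "nat rel"
  assumes "finite V" "V \<noteq> {}" "E \<subseteq> V \<times> V" "\<And>u v. (u, v) \<in> E \<Longrightarrow> u \<noteq> v" "cut_connected V E (\<lambda>x. x)"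
  shows "\<lparr>pverts = V, parcs = E \<union> E\<inverse>\<rparr> \<in> connected_graphs (card V)"
proof -
  let ?G = "\<lparr>pverts = V, parcs = E \<union> E\<inverse>\<rparr>"
  have "finite E" using assms(1,3) by (meson finite_SigmaI finite_subset)
  moreover have "(x, x) \<notin> E" for x using assms(4) by blast
  ultimately have "pair_graph ?G"
    using assms(1,3) by unfold_locales (auto simp: symmetric_def sym_def)
  then show ?thesis using cut_connected_connected[OF assms(5,2)] by (simp add: connected_graphs_def)
qed

lemma top_coeff_tree:
  fixes E :: "nat rel"
  assumes "finite V" "V \<noteq> {}" "E \<subseteq> V \<times> V" "cut_connected V E (\<lambda>x. x)" "card E < card V"
  shows "top_coeff \<lparr>pverts = V, parcs = E \<union> E\<inverse>\<rparr> = of_nat (card V)"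
proof -
  have "top_coeff \<lparr>pverts = V, parcs = E \<union> E\<inverse>\<rparr> = signed_top V E (\<lambda>x. x)"
    by (simp add: top_coeff_def signed_top_def chromatic_sym_eq colouring_series_symcl)
  then show ?thesis using signed_top_tree[OF assms(1-4)] assms(5) by simp
qed

text \<open>The top coefficient of \<open>U\<close> is squeezed between \<open>n\<close> and that of
  \<open>T\<close>.\<close>

lemma minimal_top_coeff_maximal:
  assumes "T \<in> connected_graphs n" "top_coeff T = of_nat n" "U \<in> connected_graphs n" "e_positive (X_e U T)"
  shows "chromatic_sym U = chromatic_sym T"
  using e_positive_X_e[OF assms(3,1,4)] top_coeff_ge[OF assms(3)] assms(2) by simp

lemma cut_connected_star: "cut_connected {..<n} ((\<lambda>i. (0, i)) ` {1..<n}) (\<lambda>x. x :: nat)"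
  unfolding cut_connected_def
proof (intro allI impI)
  fix A :: "nat set" assume A: "A \<subseteq> {..<n}" "A \<noteq> {}" "A \<noteq> {..<n}"
  obtain a b where ab: "a \<in> A" "b \<in> {..<n} - A" using A by blast
  have edge: "(0, x) \<in> (\<lambda>i. (0, i)) ` {1..<n}" if "x < n" "x \<noteq> 0" for x :: nat
    using that by auto
  show "\<exists>u\<in>A. \<exists>v\<in>{..<n} - A. (u, v) \<in> (\<lambda>i. (0, i)) ` {1..<n} \<or> (v, u) \<in> (\<lambda>i. (0, i)) ` {1..<n} \<or> u = v"
  \<comment> \<open>The centre lies on one side of the cut and is adjacent to any vertex of the
    other.\<close>
  proof (cases "0 \<in> A")
    case True
    then have "b < n" "b \<noteq> 0" using ab by (blast, metis DiffD2)
    with True show ?thesis using edge ab by blast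
  next
    case False
    then have "a < n" "a \<noteq> 0" using ab A by (blast, metis)
    moreover from this have "0 \<in> {..<n} - A" using False by simp
    ultimately show ?thesis using edge ab by blast
  qed
qed

lemma cut_connected_path: "cut_connected {..<n} ((\<lambda>i. (i, Suc i)) ` {..<n - 1}) (\<lambda>x. x)"
  unfolding cut_connected_def
proof (intro allI impI, rule ccontr)
  fix A assume A: "A \<subseteq> {..<n}" "A \<noteq> {}" "A \<noteq> {..<n}"
    and no: "\<not> (\<exists>u\<in>A. \<exists>v\<in>{..<n} - A. (u, v) \<in> (\<lambda>i. (i, Suc i)) ` {..<n - 1} \<or> (v, u) \<in> (\<lambda>i. (i, Suc i)) ` {..<n - 1} \<or> u = v)"
  \<comment> \<open>Membership in an uncrossed cut propagates along the path, so it is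
    constant.\<close>
  have step: "i \<in> A \<longleftrightarrow> Suc i \<in> A" if "Suc i < n" for i
  proof -
    have "(i, Suc i) \<in> (\<lambda>i. (i, Suc i)) ` {..<n - 1}" using that by auto
    moreover have "i \<in> {..<n}" "Suc i \<in> {..<n}" using that by auto
    ultimately show ?thesis using no by blast
  qed
  have "i < n \<Longrightarrow> i \<in> A \<longleftrightarrow> 0 \<in> A" for i
    by (induction i) (use step in auto)
  then show False using A by blast
qed

lemma star_path_distinct:
  assumes n: "n \<ge> 4"
  shows "colouring_series {..<n} ((\<lambda>i. (0, i)) ` {1..<n}) (\<lambda>x. x) \<noteq>
    colouring_series {..<n} ((\<lambda>i. (i, Suc i)) ` {..<n - 1}) (\<lambda>x. x)"
proof
  \<comment> \<open>One vertex of colour 0 and all others of colour 1; the star realizes this with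
    its centre coloured 0.\<close>
  let ?m = "add_mset 0 (replicate_mset (n - 1) (1::nat))"
  let ?C = "\<lambda>E. {\<kappa> \<in> blown_colourings {..<n} E (\<lambda>x. x). image_mset \<kappa> (mset_set {..<n}) = ?m}"
  assume "colouring_series {..<n} ((\<lambda>i. (0, i)) ` {1..<n}) (\<lambda>x. x) =
    colouring_series {..<n} ((\<lambda>i. (i, Suc i)) ` {..<n - 1}) (\<lambda>x. x)"
  from arg_cong[OF this, of "\<lambda>F. mcoeff F ?m"]
  have eq: "card (?C ((\<lambda>i. (0, i)) ` {1..<n})) = card (?C ((\<lambda>i. (i, Suc i)) ` {..<n - 1}))"
    by (simp add: mcoeff_colouring_series)
  let ?k = "\<lambda>i\<in>{..<n}. if i = 0 then 0 else 1 :: nat"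
  have "image_mset ?k (mset_set {..<n}) = ?m"
  proof -
    have "{..<n} = insert 0 {1..<n}" using n by auto
    then have "mset_set {..<n} = add_mset 0 (mset_set {1..<n})" by simp
    moreover have "image_mset ?k (mset_set {1..<n}) = image_mset (\<lambda>_. 1) (mset_set {1..<n})"
      by (rule image_mset_cong) auto
    ultimately show ?thesis using n by (simp add: image_mset_const_eq)
  qed
  moreover have "?k \<in> blown_colourings {..<n} ((\<lambda>i. (0, i)) ` {1..<n}) (\<lambda>x. x)"
    by (auto simp: blown_colourings_def)
  ultimately have "?C ((\<lambda>i. (0, i)) ` {1..<n}) \<noteq> {}" by blast
  moreover have "finite (?C ((\<lambda>i. (0, i)) ` {1..<n}))"
    by (rule finite_blown_colourings) simp
  ultimately have star: "card (?C ((\<lambda>i. (0, i)) ` {1..<n})) \<noteq> 0"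
    by (simp only: card_eq_0_iff de_Morgan_disj not_not simp_thms)
  have path: "?C ((\<lambda>i. (i, Suc i)) ` {..<n - 1}) = {}"
  proof (rule ccontr)
    assume "?C ((\<lambda>i. (i, Suc i)) ` {..<n - 1}) \<noteq> {}"
    then obtain \<kappa> where k: "\<kappa> \<in> blown_colourings {..<n} ((\<lambda>i. (i, Suc i)) ` {..<n - 1}) (\<lambda>x. x)"
      and m: "image_mset \<kappa> (mset_set {..<n}) = ?m" by blast
    have "\<kappa> ` {..<n} = set_mset ?m" using arg_cong[OF m, of set_mset] by simp
    then have range: "\<kappa> i = 0 \<or> \<kappa> i = 1" if "i < n" for i using that n by (auto split: if_splits)
    have "count (image_mset \<kappa> (mset_set {..<n})) 0 = card {i \<in> {..<n}. \<kappa> i = 0}"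
      by (simp add: count_image_mset vimage_def Int_def conj_commute)
    then have "card {i \<in> {..<n}. \<kappa> i = 0} = 1" by (simp add: m)
    then obtain j where j: "{i \<in> {..<n}. \<kappa> i = 0} = {j}" by (auto simp: card_1_singleton_iff)
    have adj: "\<kappa> i \<noteq> \<kappa> (Suc i)" if "i < n - 1" for i
      using k that unfolding blown_colourings_def by blast
    have zero: "i = j" if "i < n" "\<kappa> i = 0" for i
      using arg_cong[OF j, of "\<lambda>X. i \<in> X"] that by simp
    have "i = j \<or> Suc i = j" if "Suc i < n" for i
    proof -
      have "\<kappa> i \<noteq> \<kappa> (Suc i)" using adj that by simp
      then have "\<kappa> i = 0 \<or> \<kappa> (Suc i) = 0" using range[of i] range[of "Suc i"] that by fastforce
      then show ?thesis using zero that by auto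
    qed
    \<comment> \<open>The edges {0,1} and {2,3} would both contain the only vertex of colour 0, yet
      they are disjoint; the second one exists because n is at least 4.\<close>
    from this[of 0] this[of 2] show False using n by auto
  qed
  show False using star unfolding eq path by simp
qed

theorem corollary3p14:
  fixes n :: nat
  assumes "n \<ge> 4"
  shows "partial_order (e_poset n) \<and> \<not> Lattice.lattice (e_poset n)"
proof
  show "partial_order (e_poset n)" by (rule partial_order_e_poset)
  let ?V = "{..<n}"
  \<comment> \<open>One arc per edge, so that counting arcs detects trees; \<open>T1\<close> and
    \<open>T2\<close> add the reverse arcs.\<close>
  define S P where "S = (\<lambda>i. (0 :: nat, i)) ` {1..<n}" and "P = (\<lambda>i. (i, Suc i)) ` {..<n - 1}"
  define T1 T2 where "T1 = \<lparr>pverts = ?V, parcs = S \<union> S\<inverse>\<rparr>" and "T2 = \<lparr>pverts = ?V, parcs = P \<union> P\<inverse>\<rparr>"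
  have V: "finite ?V" "?V \<noteq> {}" using assms by (auto simp: lessThan_empty_iff)
  have S: "S \<subseteq> ?V \<times> ?V" "\<And>u v. (u, v) \<in> S \<Longrightarrow> u \<noteq> v" "cut_connected ?V S (\<lambda>x. x)" "card S < card ?V"
    using assms cut_connected_star[of n] by (auto simp: S_def card_image inj_on_def)
  have P: "P \<subseteq> ?V \<times> ?V" "\<And>u v. (u, v) \<in> P \<Longrightarrow> u \<noteq> v" "cut_connected ?V P (\<lambda>x. x)" "card P < card ?V"
    using assms cut_connected_path[of n] by (auto simp: P_def card_image inj_on_def)
  have T: "T1 \<in> connected_graphs n" "T2 \<in> connected_graphs n"
    "top_coeff T1 = of_nat n" "top_coeff T2 = of_nat n"
    using tree_in_connected_graphs[OF V S(1-3)] tree_in_connected_graphs[OF V P(1-3)]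
      top_coeff_tree[OF V S(1,3,4)] top_coeff_tree[OF V P(1,3,4)]
    by (simp_all add: T1_def T2_def)
  have ne: "chromatic_sym T1 \<noteq> chromatic_sym T2"
    using star_path_distinct[OF assms]
    by (simp add: T1_def T2_def S_def P_def chromatic_sym_eq colouring_series_symcl)
  show "\<not> Lattice.lattice (e_poset n)"
  proof
    assume "Lattice.lattice (e_poset n)"
    then interpret Lattice.lattice "e_poset n" .
    let ?c = "\<lambda>G. chromatic_equiv n `` {G}"
    have car: "?c G \<in> carrier (e_poset n)" if "G \<in> connected_graphs n" for G
      using that by (auto simp: e_poset_def intro: quotientI)
    obtain D where "least (e_poset n) D (Upper (e_poset n) {?c T1, ?c T2})"
      using sup_of_two_exists[OF car car] T by blast
    then have D: "D \<in> Upper (e_poset n) {?c T1, ?c T2}" by (simp add: least_def)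
    then obtain U where U: "U \<in> connected_graphs n" "D = ?c U"
      using chromatic_class[of D n] by (auto simp: Upper_def e_poset_def)
    have "le (e_poset n) (?c T) (?c U)" if "T \<in> {T1, T2}" for T
      using D that car T by (auto simp: Upper_def U(2))
    then have "e_positive (X_e U T1)" "e_positive (X_e U T2)"
      using e_poset_le_iff[OF U(1)] T by auto
    then show False using minimal_top_coeff_maximal U(1) T ne by metis
  qed
qed

end
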